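(* Let $L:\mathbb{T}\times\mathbb{R}^n\times\mathbb{R}^n\to\mathbb{R}$, $(t,y,v)\mapsto L(t,y,v)$, be such that $(y,v)\mapsto L(t,y,v)$ is of class $C^2$ for each $t\in\mathbb{T}$. Suppose $y_\ast\in C^1_{rd}[\mathbb{T}]$ is a weak local minimizer of the problem $$\mathcal{L}[y(\cdot)]=\int_a^b L(t,y(t),y^\Delta(t))\,\Delta t\longrightarrow\min,\qquad y(\cdot)\in C^1_{rd}[\mathbb{T}],\qquad (y(a)=y_a),\ (y(b)=y_b),$$ where each of the two endpoint conditions in parentheses may or may not be present. Then there exists $c\in\mathbb{R}^n$ such that $$L_{y^\Delta}(t,y_\ast(t),y_\ast^\Delta(t))=\int_a^{\sigma(t)}L_y(\xi,y_\ast(\xi),y_\ast^\Delta(\xi))\,\Delta\xi+c\qquad\text{for all } t\in\mathbb{T}^k .$$ Moreover, if the condition $y(a)=y_a$ is not present ($y(a)$ is free), then $$L_{y^\Delta}(a,y_\ast(a),y_\ast^\Delta(a))-\mu(a)L_y(a,y_\ast(a),y_\ast^\Delta(a))=0;$$ if the condition $y(b)=y_b$ is not present ($y(b)$ is free), then $$L_{y^\Delta}(\rho(b),y_\ast(\rho(b)),y_\ast^\Delta(\rho(b)))=0 .$$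
   Context: A time scale is a nonempty closed subset of $\mathbb{R}$. Throughout $\mathbb{T}=[a,b]\cap\mathbb{T}_0$ with $a<b$ and $\mathbb{T}_0$ a time scale, where $a=\min\mathbb{T}$ and $b=\max\mathbb{T}$; it is assumed that $\mathbb{T}$ has at least 3 points. The forward jump operator is $\sigma(t)=\inf\{s\in\mathbb{T}:s>t\}$ (with $\sigma(b)=b$), the backward jump operator is $\rho(t)=\sup\{s\in\mathbb{T}:s<t\}$ (with $\rho(a)=a$), and the graininess is $\mu(t)=\sigma(t)-t$. A point $t$ is right-dense if $\sigma(t)=t$, right-scattered if $\sigma(t)>t$, left-dense if $\rho(t)=t$, left-scattered if $\rho(t)<t$. $\mathbb{T}^k=\mathbb{T}\setminus(\rho(b),b]$. A function $f$ on $\mathbb{T}$ is delta differentiable at $t\in\mathbb{T}^k$ with delta derivative $f^\Delta(t)$ if for all $\varepsilon>0$ there is a neighborhood $U=(t-\delta,t+\delta)\cap\mathbb{T}$ with $|f(\sigma(t))-f(s)-f^\Delta(t)(\sigma(t)-s)|\le\varepsilon|\sigma(t)-s|$ for all $s\in U$. A function is rd-continuous if it is continuous at right-dense points and its left-sided limit exists at left-dense points. $C_{rd}[\mathbb{T}]$ is the set of rd-continuous functions; $C^1_{rd}[\mathbb{T}]$ is the set of (here $\mathbb{R}^n$-valued) delta differentiable functions on $\mathbb{T}$ with rd-continuous delta derivative on $\mathbb{T}^k$. The delta integral is $\int_c^d f(t)\Delta t=F(d)-F(c)$ where $F^\Delta=f$. $L_y$ and $L_{y^\Delta}$ denote the partial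 derivatives (gradients) of $L(t,y,v)$ with respect to the second argument $y$ and the third argument $v$, respectively. $y_\ast\in C^1_{rd}[\mathbb{T}]$ is a weak local minimizer if it satisfies the boundary conditions present and there is $\delta>0$ such that $\mathcal{L}[y_\ast]\le\mathcal{L}[y]$ for all $y\in C^1_{rd}[\mathbb{T}]$ satisfying the boundary conditions present and $\|y-y_\ast\|_{1,\infty}<\delta$, where $\|y\|_{1,\infty}=\sup_{t\in\mathbb{T}^k}|y(t)|+\sup_{t\in\mathbb{T}^k}|y^\Delta(t)|$.
   Formalization: The formal theorem additionally assumes that L, L_y and L_{y^Δ} are jointly rd-continuous in (t,(y,v)): jointly continuous at right-dense t, with joint left limits at left-dense t; with only C² in (y,v) for each t the claim can fail. *)

theory Defs
  imports "HOL-Analysis.Analysis"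
begin

(* Functions on a time scale T are represented by total functions on the reals; everything below
   depends only on their values on T. *)

definition time_scale :: "real set \<Rightarrow> bool" where
  "time_scale T \<longleftrightarrow> T \<noteq> {} \<and> closed T"

(* The case split realises the conventions sigma(max T) = max T and rho(min T) = min T. *)

definition fwd_jump :: "real set \<Rightarrow> real \<Rightarrow> real" where
  "fwd_jump T t = (if \<exists>s\<in>T. t < s then Inf {s \<in> T. t < s} else t)"

definition bwd_jump :: "real set \<Rightarrow> real \<Rightarrow> real" where
  "bwd_jump T t = (if \<exists>s\<in>T. s < t then Sup {s \<in> T. s < t} else t)"

definition graininess :: "real set \<Rightarrow> real \<Rightarrow> real" where
  "graininess T t = fwd_jump T t - t"

definition right_dense :: "real set \<Rightarrow> real \<Rightarrow> bool" where
  "right_dense T t \<longleftrightarrow> fwd_jump T t = t"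

definition left_dense :: "real set \<Rightarrow> real \<Rightarrow> bool" where
  "left_dense T t \<longleftrightarrow> bwd_jump T t = t"

(* T^k = T - (rho(b), b] with b = max T. *)

definition ts_kappa :: "real set \<Rightarrow> real set" where
  "ts_kappa T = T - {bwd_jump T (Sup T)<..Sup T}"

definition has_delta_derivative ::
  "real set \<Rightarrow> (real \<Rightarrow> 'a::real_normed_vector) \<Rightarrow> 'a \<Rightarrow> real \<Rightarrow> bool" where
  "has_delta_derivative T f D t \<longleftrightarrow> t \<in> ts_kappa T \<and>
     (\<forall>\<epsilon>>0. \<exists>\<delta>>0. \<forall>s \<in> {t - \<delta><..<t + \<delta>} \<inter> T.
        norm (f (fwd_jump T t) - f s - (fwd_jump T t - s) *\<^sub>R D) \<le> \<epsilon> * \<bar>fwd_jump T t - s\<bar>)"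

definition delta_deriv ::
  "real set \<Rightarrow> (real \<Rightarrow> 'a::real_normed_vector) \<Rightarrow> real \<Rightarrow> 'a" where
  "delta_deriv T f t = (THE D. has_delta_derivative T f D t)"

(* S is the domain of f (T or T^k); the jump operators are always those of T. *)

definition rd_continuous_on ::
  "real set \<Rightarrow> real set \<Rightarrow> (real \<Rightarrow> 'a::real_normed_vector) \<Rightarrow> bool" where
  "rd_continuous_on T S f \<longleftrightarrow>
     (\<forall>t\<in>S. right_dense T t \<longrightarrow> continuous (at t within S) f) \<and>
     (\<forall>t\<in>S. left_dense T t \<longrightarrow> (\<exists>l. (f \<longlongrightarrow> l) (at t within {s \<in> S. s < t})))"

definition C1_rd :: "real set \<Rightarrow> (real \<Rightarrow> 'a::real_normed_vector) set" where
  "C1_rd T = {f. (\<forall>t\<in>ts_kappa T. \<exists>D. has_delta_derivative T f D t) \<and>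
                 rd_continuous_on T (ts_kappa T) (delta_deriv T f)}"

definition delta_antiderivative ::
  "real set \<Rightarrow> (real \<Rightarrow> 'a::real_normed_vector) \<Rightarrow> (real \<Rightarrow> 'a) \<Rightarrow> bool" where
  "delta_antiderivative T f F \<longleftrightarrow> (\<forall>t\<in>ts_kappa T. has_delta_derivative T F (f t) t)"

(* For c, d in T. Antiderivatives are unique up to a constant on T, so the value does not
   depend on the choice of F; it is unspecified if f has no antiderivative. *)

definition delta_integral ::
  "real set \<Rightarrow> (real \<Rightarrow> 'a::real_normed_vector) \<Rightarrow> real \<Rightarrow> real \<Rightarrow> 'a" where
  "delta_integral T f c d = (THE I. \<exists>F. delta_antiderivative T f F \<and> I = F d - F c)"

definition gradient :: "('a::real_inner \<Rightarrow> real) \<Rightarrow> 'a \<Rightarrow> 'a" where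
  "gradient f x = (THE D. GDERIV f x :> D)"

definition class_C2 :: "('a::real_normed_vector \<Rightarrow> 'b::real_normed_vector) \<Rightarrow> bool" where
  "class_C2 f \<longleftrightarrow>
     (\<exists>(f' :: 'a \<Rightarrow> 'a \<Rightarrow>\<^sub>L 'b) (f'' :: 'a \<Rightarrow> 'a \<Rightarrow>\<^sub>L 'a \<Rightarrow>\<^sub>L 'b).
        (\<forall>z. (f has_derivative blinfun_apply (f' z)) (at z)) \<and>
        (\<forall>z. (f' has_derivative blinfun_apply (f'' z)) (at z)) \<and>
        continuous_on UNIV f'')"

definition grad_y :: "(real \<Rightarrow> 'a::real_inner \<Rightarrow> 'a \<Rightarrow> real) \<Rightarrow> real \<Rightarrow> 'a \<Rightarrow> 'a \<Rightarrow> 'a" where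
  "grad_y L t y v = gradient (\<lambda>x. L t x v) y"

definition grad_v :: "(real \<Rightarrow> 'a::real_inner \<Rightarrow> 'a \<Rightarrow> real) \<Rightarrow> real \<Rightarrow> 'a \<Rightarrow> 'a \<Rightarrow> 'a" where
  "grad_v L t y v = gradient (\<lambda>w. L t y w) v"

(* Rd-continuity of a function of t with parameters (y, v), in the sense of Hilger: joint
   continuity where t is right-dense, and a joint left-sided limit where t is left-dense. It
   guarantees that t |-> G t (y t) (v t) is rd-continuous for continuous y and rd-continuous v. *)

definition jointly_rd_continuous ::
  "real set \<Rightarrow> (real \<Rightarrow> 'a::real_normed_vector \<Rightarrow> 'a \<Rightarrow> 'b::real_normed_vector) \<Rightarrow> bool" where
  "jointly_rd_continuous T G \<longleftrightarrow>
     (\<forall>t\<in>T. right_dense T t \<longrightarrow>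
        (\<forall>y v. continuous (at (t, y, v) within T \<times> UNIV) (\<lambda>(s, x, w). G s x w))) \<and>
     (\<forall>t\<in>T. left_dense T t \<longrightarrow>
        (\<forall>y v. \<exists>l. ((\<lambda>(s, x, w). G s x w) \<longlongrightarrow> l)
                      (at (t, y, v) within {s \<in> T. s < t} \<times> UNIV)))"

definition functional ::
  "real set \<Rightarrow> real \<Rightarrow> real \<Rightarrow> (real \<Rightarrow> 'a::real_inner \<Rightarrow> 'a \<Rightarrow> real) \<Rightarrow> (real \<Rightarrow> 'a) \<Rightarrow> real" where
  "functional T a b L y = delta_integral T (\<lambda>t. L t (y t) (delta_deriv T y t)) a b"

definition norm_1_inf :: "real set \<Rightarrow> (real \<Rightarrow> 'a::real_normed_vector) \<Rightarrow> real" where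
  "norm_1_inf T y = (SUP t\<in>ts_kappa T. norm (y t)) + (SUP t\<in>ts_kappa T. norm (delta_deriv T y t))"

(* Boundary data: Some v prescribes the value v at the endpoint, None leaves it free. *)

definition admissible ::
  "real set \<Rightarrow> real \<Rightarrow> real \<Rightarrow> 'a option \<Rightarrow> 'a option \<Rightarrow> (real \<Rightarrow> 'a::real_normed_vector) set" where
  "admissible T a b y\<^sub>a y\<^sub>b =
     {y \<in> C1_rd T. (\<forall>\<alpha>. y\<^sub>a = Some \<alpha> \<longrightarrow> y a = \<alpha>) \<and> (\<forall>\<beta>. y\<^sub>b = Some \<beta> \<longrightarrow> y b = \<beta>)}"

definition weak_local_minimizer ::
  "real set \<Rightarrow> real \<Rightarrow> real \<Rightarrow> (real \<Rightarrow> 'a::real_inner \<Rightarrow> 'a \<Rightarrow> real) \<Rightarrow>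
     'a option \<Rightarrow> 'a option \<Rightarrow> (real \<Rightarrow> 'a) \<Rightarrow> bool" where
  "weak_local_minimizer T a b L y\<^sub>a y\<^sub>b y \<longleftrightarrow>
     y \<in> admissible T a b y\<^sub>a y\<^sub>b \<and>
     (\<exists>\<delta>>0. \<forall>x \<in> admissible T a b y\<^sub>a y\<^sub>b.
        norm_1_inf T (\<lambda>t. x t - y t) < \<delta> \<longrightarrow> functional T a b L y \<le> functional T a b L x)"

end

theory Submission
  imports Defs
begin

text \<open>
Let K be the set of points of T at which delta derivatives live, and write \<open>v\<close> for the delta
derivative of the minimizer \<open>y\<close>.  For a variation \<open>h\<close> with delta derivative \<open>w\<close> that vanishes at the
prescribed endpoints, \<open>e \<mapsto> \<L>[y + e h]\<close> has a minimum at \<open>e = 0\<close>, so its derivative there vanishes: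
\<open>\<integral> (h \<bullet> L\<^sub>y + w \<bullet> L\<^sub>v) \<Delta>t = 0\<close>.  With \<open>A(t) = \<integral>\<^sub>a\<^sup>t L\<^sub>y \<Delta>\<xi>\<close>, the product rule for \<open>A \<bullet> h\<close> turns this into
\<open>\<integral> w \<bullet> (L\<^sub>v - A \<circ> \<sigma>) \<Delta>t = - A(b) \<bullet> h(b)\<close>.  Taking all \<open>w\<close> of integral zero, the du Bois-Reymond lemma shows
that \<open>L\<^sub>v - A \<circ> \<sigma>\<close> is a constant \<open>c\<close>.  Inserting affine \<open>h\<close> that do not vanish at a free endpoint
then gives \<open>c = 0\<close> if \<open>y(a)\<close> is free and \<open>A(b) + c = 0\<close> if \<open>y(b)\<close> is free, and these become the
transversality conditions because \<open>A(\<sigma>(a)) = \<mu>(a) L\<^sub>y(a)\<close> and \<open>\<sigma>(\<rho>(b)) = b\<close>.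

The analysis behind this is reduced to ordinary integrals over \<open>[a, b]\<close>.  An rd-continuous function
\<open>f\<close> on K is extended to a step-like function \<open>x \<mapsto> f (floor_K x)\<close> that is constant on the gaps; this extension is
regulated, hence Henstock-Kurzweil integrable, and its indefinite integral is a delta
antiderivative of \<open>f\<close> (\<open>primitive_antiderivative\<close>).  Antiderivatives are unique up to a constant
(\<open>delta_derivative_zero_constant\<close>), so the delta integral is the ordinary integral of
the extension.  Differentiation of the functional along \<open>h\<close> (\<open>first_variation\<close>) is then an application of the
dominated convergence theorem; the dominating constant comes from a compactness argument that bounds
the gradients of \<open>L\<close> in a tube around the curve \<open>t \<mapsto> (y t, v t)\<close> (\<open>jointly_rd_tube_bounded\<close>).
\<close>

section \<open>Points and jumps of a compact time scale\<close>

locale compact_time_scale =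
  fixes T :: "real set" and a b :: real
  assumes closed_T: "closed T"
    and T_subset: "T \<subseteq> {a..b}"
    and a_in_T: "a \<in> T"
    and b_in_T: "b \<in> T"
    and a_less_b: "a < b"
begin

abbreviation K :: "real set" where "K \<equiv> ts_kappa T"
abbreviation \<sigma> :: "real \<Rightarrow> real" where "\<sigma> \<equiv> fwd_jump T"

lemma Sup_T: "Sup T = b"
  using T_subset b_in_T by (intro cSup_eq_maximum) auto

lemma T_bounds: "t \<in> T \<Longrightarrow> a \<le> t" "t \<in> T \<Longrightarrow> t \<le> b"
  using T_subset by auto

lemma closed_subset_Sup_mem:
  assumes "closed S" "S \<noteq> {}" "S \<subseteq> {a..b}"
  shows "Sup S \<in> S"
  using assms bdd_above_mono[OF bdd_above_Icc[of a b]] by (intro closed_contains_Sup) auto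

lemma fwd_jump_props:
  assumes "t \<in> T"
  shows fwd_jump_in: "\<sigma> t \<in> T" and fwd_jump_ge: "t \<le> \<sigma> t"
    and fwd_jump_le: "\<And>s. s \<in> T \<Longrightarrow> t < s \<Longrightarrow> \<sigma> t \<le> s"
proof -
  have "\<sigma> t \<in> T \<and> t \<le> \<sigma> t \<and> (\<forall>s\<in>T. t < s \<longrightarrow> \<sigma> t \<le> s)"
  proof (cases "\<exists>s\<in>T. t < s")
    case True
    let ?S = "{s \<in> T. t < s}"
    have ne: "?S \<noteq> {}" and bd: "bdd_below ?S"
      using True T_bounds by (auto simp: bdd_below_def)
    have "Inf ?S \<in> closure ?S" using ne bd by (rule closure_contains_Inf)
    also have "closure ?S \<subseteq> T"
      using closed_T by (intro closure_minimal) auto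
    finally have 1: "Inf ?S \<in> T" .
    have 2: "t \<le> Inf ?S" using ne by (intro cInf_greatest) auto
    have 3: "\<forall>s\<in>T. t < s \<longrightarrow> Inf ?S \<le> s" using bd by (auto intro: cInf_lower)
    show ?thesis using True 1 2 3 by (simp add: fwd_jump_def)
  next
    case False
    then show ?thesis using assms by (auto simp: fwd_jump_def)
  qed
  then show "\<sigma> t \<in> T" "t \<le> \<sigma> t" "\<And>s. s \<in> T \<Longrightarrow> t < s \<Longrightarrow> \<sigma> t \<le> s" by auto
qed

lemma right_dense_approx:
  assumes "t \<in> T" "right_dense T t" "t < b" "t < u"
  obtains s where "s \<in> T" "t < s" "s < u"
proof -
  have ex: "\<exists>s\<in>T. t < s" using assms b_in_T by auto
  then have "Inf {s \<in> T. t < s} = t" using assms by (simp add: right_dense_def fwd_jump_def)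
  then have "Inf {s \<in> T. t < s} < u" using assms by simp
  then have "\<exists>s\<in>{s \<in> T. t < s}. s < u"
    using ex T_bounds by (subst (asm) cInf_less_iff) (auto simp: bdd_below_def)
  then show ?thesis using that by auto
qed

lemma right_denseI:
  assumes "t \<in> T" "\<And>u. t < u \<Longrightarrow> \<exists>s\<in>T. t < s \<and> s < u"
  shows "right_dense T t"
  using assms fwd_jump_ge[of t] fwd_jump_le[of t] unfolding right_dense_def
  by (meson linorder_not_less order_antisym)

lemma left_denseI:
  assumes "t \<in> T" "\<And>u. u < t \<Longrightarrow> \<exists>s\<in>T. u < s \<and> s < t"
  shows "left_dense T t"
proof -
  have ex: "\<exists>s\<in>T. s < t" using assms(2)[of "t - 1"] by auto
  have "Sup {s \<in> T. s < t} = t"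
  proof (rule cSup_eq_non_empty)
    show "{s \<in> T. s < t} \<noteq> {}" using ex by auto
    show "\<And>x. x \<in> {s \<in> T. s < t} \<Longrightarrow> x \<le> t" by auto
    show "t \<le> y" if "\<And>x. x \<in> {s \<in> T. s < t} \<Longrightarrow> x \<le> y" for y
    proof (rule ccontr)
      assume "\<not> t \<le> y"
      then obtain s where "s \<in> T" "y < s" "s < t" using assms(2)[of y] by auto
      then show False using that[of s] by auto
    qed
  qed
  then show ?thesis using ex by (simp add: left_dense_def bwd_jump_def)
qed

text \<open>
The hypothesis is that some \<open>u < t\<close> bounds all earlier points, which is the form of left-scatteredness that
order arguments deliver.  The supremum of the earlier points is then attained, and nothing of T lies
between it and \<open>t\<close>.
\<close>
lemma left_scattered_pred:
  assumes "t \<in> T" "a < t" "u < t" "\<And>s. s \<in> T \<Longrightarrow> s < t \<Longrightarrow> s \<le> u"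
  shows "bwd_jump T t \<in> T" "bwd_jump T t < t" "\<sigma> (bwd_jump T t) = t"
    "\<And>s. s \<in> T \<Longrightarrow> s < t \<Longrightarrow> s \<le> bwd_jump T t"
proof -
  have eq: "{s \<in> T. s < t} = T \<inter> {..u}" using assms by force
  have ne: "{s \<in> T. s < t} \<noteq> {}" using a_in_T assms by auto
  then have 0: "bwd_jump T t = Sup {s \<in> T. s < t}" by (auto simp: bwd_jump_def)
  have "Sup {s \<in> T. s < t} \<in> {s \<in> T. s < t}"
    using ne closed_T T_subset unfolding eq by (intro closed_subset_Sup_mem) (auto)
  then show 1: "bwd_jump T t \<in> T" "bwd_jump T t < t" using 0 by auto
  show 2: "\<And>s. s \<in> T \<Longrightarrow> s < t \<Longrightarrow> s \<le> bwd_jump T t"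
    unfolding 0 by (rule cSup_upper) (auto intro!: bdd_aboveI less_imp_le)
  have "t \<le> \<sigma> (bwd_jump T t)"
  proof (rule ccontr)
    assume n: "\<not> ?thesis"
    then have "\<sigma> (bwd_jump T t) \<le> bwd_jump T t" using fwd_jump_in[OF 1(1)] 2 by auto
    then have "right_dense T (bwd_jump T t)" 
      using fwd_jump_ge[OF 1(1)] by (simp add: right_dense_def)
    then obtain s where "s \<in> T" "bwd_jump T t < s" "s < t"
      using right_dense_approx[of "bwd_jump T t" t] 1 T_bounds[OF assms(1)] by auto
    then show False using 2[of s] by auto
  qed
  then show "\<sigma> (bwd_jump T t) = t" using fwd_jump_le[OF 1(1) assms(1) 1(2)] by auto
qed

lemma bwd_jump_b: "bwd_jump T b \<le> b" "\<And>s. s \<in> T \<Longrightarrow> s < b \<Longrightarrow> s \<le> bwd_jump T b"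
proof -
  have eq: "bwd_jump T b = Sup {s \<in> T. s < b}"
    using a_in_T a_less_b by (auto simp: bwd_jump_def)
  show "bwd_jump T b \<le> b" unfolding eq
    using a_in_T a_less_b by (intro cSup_least) auto
  show "\<And>s. s \<in> T \<Longrightarrow> s < b \<Longrightarrow> s \<le> bwd_jump T b"
    unfolding eq by (rule cSup_upper) (auto intro!: bdd_aboveI less_imp_le)
qed

lemma kappa_iff: "t \<in> K \<longleftrightarrow> t \<in> T \<and> (t < b \<or> bwd_jump T b = b)"
  using bwd_jump_b T_bounds unfolding ts_kappa_def Sup_T by force

lemma kappa_in_T: "t \<in> K \<Longrightarrow> t \<in> T"
  by (simp add: kappa_iff)

lemma below_b_kappa: "t \<in> T \<Longrightarrow> t < b \<Longrightarrow> t \<in> K"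
  by (simp add: kappa_iff)

lemma a_in_K: "a \<in> K"
  using a_in_T a_less_b by (rule below_b_kappa)

lemma kappa_down: "s \<in> T \<Longrightarrow> s \<le> t \<Longrightarrow> t \<in> K \<Longrightarrow> s \<in> K"
  using T_bounds by (force simp: kappa_iff)

lemma b_in_K_iff: "b \<in> K \<longleftrightarrow> (\<forall>u<b. \<exists>s\<in>T. u < s \<and> s < b)"
proof
  assume "b \<in> K"
  then have "bwd_jump T b = b" by (simp add: kappa_iff)
  then show "\<forall>u<b. \<exists>s\<in>T. u < s \<and> s < b"
    using left_scattered_pred(2)[OF b_in_T a_less_b] by (metis linorder_not_less order_less_irrefl)
next
  assume "\<forall>u<b. \<exists>s\<in>T. u < s \<and> s < b"
  then have "left_dense T b" using b_in_T by (intro left_denseI) auto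
  then show "b \<in> K" using b_in_T by (simp add: kappa_iff left_dense_def)
qed

text \<open>
If K differs from T, then \<open>b\<close> is isolated from the left, so only an isolated point is removed from
the closed set T.
\<close>
lemma closed_K: "closed K"
proof (cases "b \<in> K")
  case True
  then have "K = T" by (auto simp: kappa_iff)
  then show ?thesis using closed_T by simp
next
  case False
  then obtain u where "u < b" "\<forall>s\<in>T. s < b \<longrightarrow> s \<le> u" using b_in_K_iff by force
  then have "K = T \<inter> {..u}"
    using False T_bounds unfolding kappa_iff set_eq_iff by (auto simp: kappa_iff b_in_T intro: order_less_le_trans)
  then show ?thesis using closed_T by auto
qed

lemma K_subset: "K \<subseteq> {a..b}"
  using T_subset kappa_in_T by auto

lemma compact_K: "compact K"
  using closed_K K_subset bounded_subset[OF bounded_closed_interval] by (auto simp: compact_eq_bounded_closed)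

text \<open>
The transversality condition at \<open>b\<close> is the Euler-Lagrange equation at \<open>\<rho>(b)\<close>, which is the last point of K.
\<close>
lemma bwd_jump_b_kappa: "bwd_jump T b \<in> K" "\<sigma> (bwd_jump T b) = b"
proof -
  show "bwd_jump T b \<in> K"
  proof (cases "b \<in> K")
    case True
    then show ?thesis by (auto simp: kappa_iff)
  next
    case False
    then obtain u where "u < b" "\<forall>s\<in>T. s < b \<longrightarrow> s \<le> u" using b_in_K_iff by force
    then show ?thesis using left_scattered_pred(1,2)[OF b_in_T a_less_b] below_b_kappa by blast
  qed
  show "\<sigma> (bwd_jump T b) = b"
  proof (cases "b \<in> K")
    case True
    then have "bwd_jump T b = b" by (simp add: kappa_iff)
    then show ?thesis using fwd_jump_ge[OF b_in_T] T_bounds(2)[OF fwd_jump_in[OF b_in_T]] by auto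
  next
    case False
    then obtain u where "u < b" "\<forall>s\<in>T. s < b \<longrightarrow> s \<le> u" using b_in_K_iff by force
    then show ?thesis using left_scattered_pred(3)[OF b_in_T a_less_b] by blast
  qed
qed

lemma right_scattered_nhd:
  assumes "t \<in> K" "\<not> right_dense T t"
  shows "t < \<sigma> t" and "\<And>s. s \<in> K \<Longrightarrow> s < \<sigma> t \<Longrightarrow> s \<le> t"
proof -
  have t: "t \<in> T" using assms kappa_in_T by simp
  show "t < \<sigma> t" using assms(2) fwd_jump_ge[OF t] by (auto simp: right_dense_def)
  show "\<And>s. s \<in> K \<Longrightarrow> s < \<sigma> t \<Longrightarrow> s \<le> t"
    using fwd_jump_le[OF t kappa_in_T] by (meson linorder_not_less)
qed

lemma left_scattered_nhd:
  assumes "t \<in> K" "\<not> left_dense T t"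
  obtains u where "u < t" "\<And>s. s \<in> K \<Longrightarrow> u < s \<Longrightarrow> t \<le> s"
  using left_denseI[OF kappa_in_T[OF assms(1)]] assms(2) kappa_in_T not_le by metis

text \<open>
At a point of K the defining inequality of the delta derivative can be tested on some \<open>s \<noteq> \<sigma>(t)\<close> arbitrarily
close to \<open>t\<close>, and this makes the delta derivative unique.  A left-scattered maximum \<open>b\<close> has no such \<open>s\<close>.
\<close>
lemma kappa_approx:
  assumes "t \<in> K" "\<delta> > 0"
  obtains s where "s \<in> T" "\<bar>s - t\<bar> < \<delta>" "s \<noteq> \<sigma> t"
proof (cases "right_dense T t")
  case False
  then show ?thesis using that[of t] assms kappa_in_T by (auto simp: right_dense_def)
next
  case True
  have t: "t \<in> T" using assms kappa_in_T by auto
  show ?thesis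
  proof (cases "t < b")
    case True
    from right_dense_approx[OF t \<open>right_dense T t\<close> True, of "t + \<delta>"] assms
    obtain s where "s \<in> T" "t < s" "s < t + \<delta>" by auto
    then show ?thesis using that[of s] \<open>right_dense T t\<close> by (auto simp: right_dense_def)
  next
    case False
    then have "t = b" using T_bounds t by force
    then obtain s where "s \<in> T" "b - \<delta> < s" "s < b"
      using assms b_in_K_iff by (metis diff_less_eq less_add_same_cancel1)
    then show ?thesis using that[of s] \<open>right_dense T t\<close> \<open>t = b\<close> by (auto simp: right_dense_def)
  qed
qed

section \<open>Delta derivatives and uniqueness of antiderivatives\<close>

lemma has_delta_derivativeI:
  assumes "t \<in> K"
    and "\<And>e. e > 0 \<Longrightarrow> \<exists>\<delta>>0. \<forall>s\<in>T. \<bar>s - t\<bar> < \<delta> \<longrightarrow>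
          norm (f (\<sigma> t) - f s - (\<sigma> t - s) *\<^sub>R D) \<le> e * \<bar>\<sigma> t - s\<bar>"
  shows "has_delta_derivative T f D t"
  unfolding has_delta_derivative_def
proof (intro conjI allI impI)
  fix e :: real assume "e > 0"
  from assms(2)[OF this] obtain \<delta> where "\<delta> > 0" 
     "\<forall>s\<in>T. \<bar>s - t\<bar> < \<delta> \<longrightarrow> norm (f (\<sigma> t) - f s - (\<sigma> t - s) *\<^sub>R D) \<le> e * \<bar>\<sigma> t - s\<bar>" by auto
  then show "\<exists>\<delta>>0. \<forall>s \<in> {t - \<delta><..<t + \<delta>} \<inter> T.
        norm (f (\<sigma> t) - f s - (\<sigma> t - s) *\<^sub>R D) \<le> e * \<bar>\<sigma> t - s\<bar>"
    by (intro exI[of _ \<delta>]) (auto simp: abs_less_iff)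
qed (fact assms)

lemma has_delta_derivativeD:
  assumes "has_delta_derivative T f D t" "e > 0"
  obtains \<delta> where "\<delta> > 0" "\<And>s. s \<in> T \<Longrightarrow> \<bar>s - t\<bar> < \<delta> \<Longrightarrow>
    norm (f (\<sigma> t) - f s - (\<sigma> t - s) *\<^sub>R D) \<le> e * \<bar>\<sigma> t - s\<bar>"
proof -
  from assms obtain \<delta> where "\<delta> > 0" "\<forall>s \<in> {t - \<delta><..<t + \<delta>} \<inter> T.
        norm (f (\<sigma> t) - f s - (\<sigma> t - s) *\<^sub>R D) \<le> e * \<bar>\<sigma> t - s\<bar>"
    unfolding has_delta_derivative_def by blast
  then show ?thesis by (intro that[of \<delta>]) (auto simp: abs_less_iff)
qed

lemma has_delta_derivative_kappa: "has_delta_derivative T f D t \<Longrightarrow> t \<in> K"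
  by (simp add: has_delta_derivative_def)

lemma delta_derivative_unique:
  assumes "has_delta_derivative T f D t" "has_delta_derivative T f E t"
  shows "D = E"
proof (rule ccontr)
  assume ne: "D \<noteq> E"
  define e where "e = norm (D - E) / 3"
  have e: "e > 0" using ne by (simp add: e_def)
  obtain d1 where d1: "d1 > 0" "\<And>s. s \<in> T \<Longrightarrow> \<bar>s - t\<bar> < d1 \<Longrightarrow>
    norm (f (\<sigma> t) - f s - (\<sigma> t - s) *\<^sub>R D) \<le> e * \<bar>\<sigma> t - s\<bar>"
    using has_delta_derivativeD[OF assms(1) e] by blast
  obtain d2 where d2: "d2 > 0" "\<And>s. s \<in> T \<Longrightarrow> \<bar>s - t\<bar> < d2 \<Longrightarrow>
    norm (f (\<sigma> t) - f s - (\<sigma> t - s) *\<^sub>R E) \<le> e * \<bar>\<sigma> t - s\<bar>"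
    using has_delta_derivativeD[OF assms(2) e] by blast
  obtain s where s: "s \<in> T" "\<bar>s - t\<bar> < min d1 d2" "s \<noteq> \<sigma> t"
    using kappa_approx[OF has_delta_derivative_kappa[OF assms(1)], of "min d1 d2"] d1 d2 by auto
  let ?u = "f (\<sigma> t) - f s"
  have "\<bar>\<sigma> t - s\<bar> * norm (D - E) = norm ((\<sigma> t - s) *\<^sub>R D - (\<sigma> t - s) *\<^sub>R E)"
    by (metis norm_scaleR real_norm_def scaleR_diff_right)
  also have "\<dots> = norm ((?u - (\<sigma> t - s) *\<^sub>R E) - (?u - (\<sigma> t - s) *\<^sub>R D))"
    by simp
  also have "\<dots> \<le> e * \<bar>\<sigma> t - s\<bar> + e * \<bar>\<sigma> t - s\<bar>"
    using d1(2)[of s] d2(2)[of s] s by (intro order_trans[OF norm_triangle_ineq4]) auto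
  also have "\<dots> = \<bar>\<sigma> t - s\<bar> * (2 * e)" by simp
  finally have "norm (D - E) \<le> 2 * e" using s by auto
  then show False using ne by (simp add: e_def)
qed

lemma delta_deriv_eq: "has_delta_derivative T f D t \<Longrightarrow> delta_deriv T f t = D"
  unfolding delta_deriv_def by (blast intro: delta_derivative_unique)

text \<open>
The defining inequality at \<open>s = t\<close> holds for every \<open>\<epsilon>\<close> with the fixed factor \<open>\<mu>(t)\<close>, so it is an equality.
\<close>
lemma delta_derivative_jump:
  assumes "has_delta_derivative T f D t"
  shows "f (\<sigma> t) - f t = (\<sigma> t - t) *\<^sub>R D"
proof -
  have t: "t \<in> T" using assms by (simp add: has_delta_derivative_kappa kappa_in_T)
  have "norm (f (\<sigma> t) - f t - (\<sigma> t - t) *\<^sub>R D) \<le> 0"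
  proof (rule field_le_epsilon)
    fix e :: real assume "e > 0"
    define e' where "e' = e / (\<bar>\<sigma> t - t\<bar> + 1)"
    have "e' > 0" using \<open>e > 0\<close> by (simp add: e'_def add_nonneg_pos)
    obtain d where "d > 0" "\<And>s. s \<in> T \<Longrightarrow> \<bar>s - t\<bar> < d \<Longrightarrow>
      norm (f (\<sigma> t) - f s - (\<sigma> t - s) *\<^sub>R D) \<le> e' * \<bar>\<sigma> t - s\<bar>"
      using has_delta_derivativeD[OF assms \<open>e' > 0\<close>] by blast
    then have "norm (f (\<sigma> t) - f t - (\<sigma> t - t) *\<^sub>R D) \<le> e' * \<bar>\<sigma> t - t\<bar>" using t by simp
    also have "\<dots> \<le> e' * (\<bar>\<sigma> t - t\<bar> + 1)" using \<open>e' > 0\<close> by simp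
    also have "\<dots> = e" by (simp add: e'_def)
    finally show "norm (f (\<sigma> t) - f t - (\<sigma> t - t) *\<^sub>R D) \<le> 0 + e" by simp
  qed
  then show ?thesis by simp
qed

lemma delta_differentiable_continuous:
  assumes "has_delta_derivative T f D t"
  shows "continuous (at t within T) f"
proof -
  let ?r = "\<lambda>s. f (\<sigma> t) - f s - (\<sigma> t - s) *\<^sub>R D"
  define C where "C = \<bar>\<sigma> t - t\<bar> + 1"
  have C: "C > 0" by (simp add: C_def add_nonneg_pos)
  have r: "(?r \<longlongrightarrow> 0) (at t within T)"
  proof (rule tendstoI)
    fix e :: real assume "e > 0"
    then have e': "e / (2 * C) > 0" using C by simp
    obtain d where d: "d > 0" "\<And>s. s \<in> T \<Longrightarrow> \<bar>s - t\<bar> < d \<Longrightarrow>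
      norm (?r s) \<le> e / (2 * C) * \<bar>\<sigma> t - s\<bar>"
      using has_delta_derivativeD[OF assms e'] by blast
    have "dist (?r s) 0 < e" if "s \<in> T" "dist s t < min d 1" for s
    proof -
      have "norm (?r s) \<le> e / (2 * C) * \<bar>\<sigma> t - s\<bar>" using d that by (auto simp: dist_real_def)
      also have "\<dots> \<le> e / (2 * C) * C"
        using that e' by (intro mult_left_mono) (auto simp: C_def dist_real_def)
      also have "\<dots> < e" using C \<open>e > 0\<close> by simp
      finally show ?thesis by simp
    qed
    then show "eventually (\<lambda>s. dist (?r s) 0 < e) (at t within T)"
      unfolding eventually_at using \<open>d > 0\<close> by (intro exI[of _ "min d 1"]) auto
  qed
  have "((\<lambda>s. f (\<sigma> t) - (\<sigma> t - s) *\<^sub>R D - ?r s) \<longlongrightarrow> f (\<sigma> t) - (\<sigma> t - t) *\<^sub>R D - 0) (at t within T)"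
    by (intro tendsto_intros r)
  moreover have "f (\<sigma> t) - (\<sigma> t - t) *\<^sub>R D - 0 = f t"
    using delta_derivative_jump[OF assms] by (simp add: algebra_simps)
  ultimately show ?thesis by (simp add: continuous_within)
qed

lemma has_delta_derivative_add:
  assumes "has_delta_derivative T f D t" "has_delta_derivative T g E t"
  shows "has_delta_derivative T (\<lambda>s. f s + g s) (D + E) t"
proof (rule has_delta_derivativeI[OF has_delta_derivative_kappa[OF assms(1)]])
  fix e :: real assume "e > 0"
  then have e: "e / 2 > 0" by simp
  obtain d1 where d1: "d1 > 0" "\<And>s. s \<in> T \<Longrightarrow> \<bar>s - t\<bar> < d1 \<Longrightarrow>
    norm (f (\<sigma> t) - f s - (\<sigma> t - s) *\<^sub>R D) \<le> e / 2 * \<bar>\<sigma> t - s\<bar>"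
    using has_delta_derivativeD[OF assms(1) e] by blast
  obtain d2 where d2: "d2 > 0" "\<And>s. s \<in> T \<Longrightarrow> \<bar>s - t\<bar> < d2 \<Longrightarrow>
    norm (g (\<sigma> t) - g s - (\<sigma> t - s) *\<^sub>R E) \<le> e / 2 * \<bar>\<sigma> t - s\<bar>"
    using has_delta_derivativeD[OF assms(2) e] by blast
  have "norm (f (\<sigma> t) + g (\<sigma> t) - (f s + g s) - (\<sigma> t - s) *\<^sub>R (D + E)) \<le> e * \<bar>\<sigma> t - s\<bar>"
    if "s \<in> T" "\<bar>s - t\<bar> < min d1 d2" for s
  proof -
    have "f (\<sigma> t) + g (\<sigma> t) - (f s + g s) - (\<sigma> t - s) *\<^sub>R (D + E) =
      (f (\<sigma> t) - f s - (\<sigma> t - s) *\<^sub>R D) + (g (\<sigma> t) - g s - (\<sigma> t - s) *\<^sub>R E)"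
      by (simp add: algebra_simps)
    also have "norm \<dots> \<le> e / 2 * \<bar>\<sigma> t - s\<bar> + e / 2 * \<bar>\<sigma> t - s\<bar>"
      using d1(2)[of s] d2(2)[of s] that by (intro norm_triangle_mono) auto
    finally show ?thesis by simp
  qed
  then show "\<exists>\<delta>>0. \<forall>s\<in>T. \<bar>s - t\<bar> < \<delta> \<longrightarrow>
      norm (f (\<sigma> t) + g (\<sigma> t) - (f s + g s) - (\<sigma> t - s) *\<^sub>R (D + E)) \<le> e * \<bar>\<sigma> t - s\<bar>"
    using d1 d2 by (intro exI[of _ "min d1 d2"]) auto
qed

text \<open>
The increment is \<open>f(\<sigma>) \<bullet> (g(\<sigma>) - g(s)) + (f(\<sigma>) - f(s)) \<bullet> g(s)\<close>; replacing both increments by their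
linear parts and \<open>g(s)\<close> by \<open>g(t)\<close> in the last factor costs errors that are small relative to \<open>|\<sigma> - s|\<close>.  The jump
\<open>\<sigma>\<close> sits on one factor only.
\<close>
lemma has_delta_derivative_inner:
  fixes f g :: "real \<Rightarrow> 'a::real_inner"
  assumes f: "has_delta_derivative T f D t" and g: "has_delta_derivative T g E t"
  shows "has_delta_derivative T (\<lambda>s. f s \<bullet> g s) (D \<bullet> g t + f (\<sigma> t) \<bullet> E) t"
proof (rule has_delta_derivativeI[OF has_delta_derivative_kappa[OF f]])
  fix e :: real assume "e > 0"
  (* The summand 1 allows for norm (g s) exceeding norm (g t) by at most e' \<le> 1. *)
  define C where "C = norm (f (\<sigma> t)) + norm (g t) + norm D + 1"
  have C: "C > 0" by (simp add: C_def add_nonneg_pos)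
  define e' where "e' = min 1 (e / (C + C))"
  have e': "e' > 0" "e' \<le> 1" "e' * (C + C) \<le> e"
    using \<open>e > 0\<close> C by (auto simp: e'_def min_def field_simps)
  obtain d1 where d1: "d1 > 0" "\<And>s. s \<in> T \<Longrightarrow> \<bar>s - t\<bar> < d1 \<Longrightarrow>
    norm (f (\<sigma> t) - f s - (\<sigma> t - s) *\<^sub>R D) \<le> e' * \<bar>\<sigma> t - s\<bar>"
    using has_delta_derivativeD[OF f e'(1)] by blast
  obtain d2 where d2: "d2 > 0" "\<And>s. s \<in> T \<Longrightarrow> \<bar>s - t\<bar> < d2 \<Longrightarrow>
    norm (g (\<sigma> t) - g s - (\<sigma> t - s) *\<^sub>R E) \<le> e' * \<bar>\<sigma> t - s\<bar>"
    using has_delta_derivativeD[OF g e'(1)] by blast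
  obtain d3 where d3: "d3 > 0" "\<And>s. s \<in> T \<Longrightarrow> \<bar>s - t\<bar> < d3 \<Longrightarrow> norm (g s - g t) < e'"
    using delta_differentiable_continuous[OF g] e'(1)
    unfolding continuous_within_eps_delta by (auto simp: dist_norm)
  have "norm (f (\<sigma> t) \<bullet> g (\<sigma> t) - f s \<bullet> g s - (\<sigma> t - s) *\<^sub>R (D \<bullet> g t + f (\<sigma> t) \<bullet> E)) \<le> e * \<bar>\<sigma> t - s\<bar>"
    if s: "s \<in> T" "\<bar>s - t\<bar> < min d1 (min d2 d3)" for s
  proof -
    let ?m = "\<bar>\<sigma> t - s\<bar>"
    let ?F = "f (\<sigma> t) - f s - (\<sigma> t - s) *\<^sub>R D"
    let ?G = "g (\<sigma> t) - g s - (\<sigma> t - s) *\<^sub>R E"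
    have b: "norm ?F \<le> e' * ?m" "norm ?G \<le> e' * ?m" "norm (g s - g t) \<le> e'"
      using d1(2)[of s] d2(2)[of s] d3(2)[of s] s by auto
    have gs: "norm (g s) \<le> norm (g t) + 1"
      using b(3) e'(2) norm_triangle_ineq2[of "g s" "g t"] by linarith
    have "f (\<sigma> t) \<bullet> g (\<sigma> t) - f s \<bullet> g s - (\<sigma> t - s) *\<^sub>R (D \<bullet> g t + f (\<sigma> t) \<bullet> E) =
      f (\<sigma> t) \<bullet> ?G + ?F \<bullet> g s + (\<sigma> t - s) * (D \<bullet> (g s - g t))"
      by (simp add: inner_diff_left inner_diff_right algebra_simps)
    also have "\<bar>\<dots>\<bar> \<le> \<bar>f (\<sigma> t) \<bullet> ?G\<bar> + \<bar>?F \<bullet> g s\<bar> + ?m * \<bar>D \<bullet> (g s - g t)\<bar>"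
      unfolding abs_mult[symmetric] by linarith
    also have "\<dots> \<le> norm (f (\<sigma> t)) * (e' * ?m) + (e' * ?m) * (norm (g t) + 1) + ?m * (norm D * e')"
      using b gs e'
      by (intro add_mono mult_left_mono order_trans[OF Cauchy_Schwarz_ineq2] mult_mono) auto
    also have "\<dots> = e' * C * ?m" by (simp add: C_def algebra_simps)
    also have "\<dots> \<le> e * ?m"
      using e' C by (intro mult_right_mono) (auto simp: algebra_simps intro: order_trans[rotated])
    finally show ?thesis by simp
  qed
  then show "\<exists>\<delta>>0. \<forall>s\<in>T. \<bar>s - t\<bar> < \<delta> \<longrightarrow>
      norm (f (\<sigma> t) \<bullet> g (\<sigma> t) - f s \<bullet> g s - (\<sigma> t - s) *\<^sub>R (D \<bullet> g t + f (\<sigma> t) \<bullet> E)) \<le> e * \<bar>\<sigma> t - s\<bar>"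
    using d1 d2 d3 by (intro exI[of _ "min d1 (min d2 d3)"]) auto
qed

lemma has_delta_derivative_const:
  assumes "t \<in> K"
  shows "has_delta_derivative T (\<lambda>s. c) 0 t"
  by (rule has_delta_derivativeI[OF assms]) (auto intro: exI[of _ 1])

lemma has_delta_derivative_affine:
  assumes "t \<in> K"
  shows "has_delta_derivative T (\<lambda>s. (s - c) *\<^sub>R u) u t"
  by (rule has_delta_derivativeI[OF assms]) (auto simp: algebra_simps intro: exI[of _ 1])

lemma has_delta_derivative_scaleR:
  assumes "has_delta_derivative T f D t"
  shows "has_delta_derivative T (\<lambda>s. r *\<^sub>R f s) (r *\<^sub>R D) t"
proof (rule has_delta_derivativeI[OF has_delta_derivative_kappa[OF assms]])
  fix e :: real assume "e > 0"
  then have e: "e / (\<bar>r\<bar> + 1) > 0" by (simp add: add_nonneg_pos)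
  obtain d where d: "d > 0" "\<And>s. s \<in> T \<Longrightarrow> \<bar>s - t\<bar> < d \<Longrightarrow>
    norm (f (\<sigma> t) - f s - (\<sigma> t - s) *\<^sub>R D) \<le> e / (\<bar>r\<bar> + 1) * \<bar>\<sigma> t - s\<bar>"
    using has_delta_derivativeD[OF assms e] by blast
  have "norm (r *\<^sub>R f (\<sigma> t) - r *\<^sub>R f s - (\<sigma> t - s) *\<^sub>R r *\<^sub>R D) \<le> e * \<bar>\<sigma> t - s\<bar>"
    if "s \<in> T" "\<bar>s - t\<bar> < d" for s
  proof -
    have "r *\<^sub>R f (\<sigma> t) - r *\<^sub>R f s - (\<sigma> t - s) *\<^sub>R r *\<^sub>R D = r *\<^sub>R (f (\<sigma> t) - f s - (\<sigma> t - s) *\<^sub>R D)"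
      by (simp add: algebra_simps)
    also have "norm \<dots> = \<bar>r\<bar> * norm (f (\<sigma> t) - f s - (\<sigma> t - s) *\<^sub>R D)" by simp
    also have "\<dots> \<le> (\<bar>r\<bar> + 1) * (e / (\<bar>r\<bar> + 1) * \<bar>\<sigma> t - s\<bar>)"
      using d(2)[OF that] by (intro mult_mono) auto
    also have "\<dots> = e * \<bar>\<sigma> t - s\<bar>" by simp
    finally show ?thesis .
  qed
  then show "\<exists>\<delta>>0. \<forall>s\<in>T. \<bar>s - t\<bar> < \<delta> \<longrightarrow>
      norm (r *\<^sub>R f (\<sigma> t) - r *\<^sub>R f s - (\<sigma> t - s) *\<^sub>R r *\<^sub>R D) \<le> e * \<bar>\<sigma> t - s\<bar>"
    using d by auto
qed

text \<open>
For each \<open>e > 0\<close> the bound \<open>|h(t) - h(a)| \<le> e (t - a)\<close> propagates through T.  At the infimum \<open>m\<close> of the points where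
it fails, it still holds: by a jump from the predecessor of \<open>m\<close>, or by continuity from the left.
But then it also holds a little beyond \<open>m\<close>, since a vanishing delta derivative allows only the
slope \<open>e\<close> to the right; this contradicts the choice of \<open>m\<close>.
\<close>
lemma delta_derivative_zero_constant:
  assumes "\<And>t. t \<in> K \<Longrightarrow> has_delta_derivative T h 0 t" and "t \<in> T"
  shows "h t = h a"
proof -
  have bound: "norm (h u - h a) \<le> e * (u - a)" if "e > 0" "u \<in> T" for e u
  proof (rule ccontr)
    assume "\<not> norm (h u - h a) \<le> e * (u - a)"
    define B where "B = {t \<in> T. \<not> norm (h t - h a) \<le> e * (t - a)}"
    have ne: "B \<noteq> {}" using \<open>u \<in> T\<close> \<open>\<not> _\<close> by (auto simp: B_def)
    have bd: "bdd_below B" using T_bounds by (auto simp: B_def bdd_below_def)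
    define m where "m = Inf B"
    have "m \<in> closure B" unfolding m_def using ne bd by (rule closure_contains_Inf)
    also have "closure B \<subseteq> T" using closed_T by (intro closure_minimal) (auto simp: B_def)
    finally have m: "m \<in> T" .
    have m_le: "m \<le> s" if "s \<in> B" for s unfolding m_def using bd that by (rule cInf_lower[rotated])
    have below: "norm (h s - h a) \<le> e * (s - a)" if "s \<in> T" "s < m" for s
      using m_le[of s] that by (auto simp: B_def)
    have Pm: "norm (h m - h a) \<le> e * (m - a)"
    proof (cases "m = a")
      case False
      then have "a < m" using T_bounds(1)[OF m] by simp
      show ?thesis
      proof (cases "\<exists>u<m. \<forall>s\<in>T. s < m \<longrightarrow> s \<le> u")
        case True
        then obtain u where "u < m" "\<And>s. s \<in> T \<Longrightarrow> s < m \<Longrightarrow> s \<le> u" by auto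
        note r = left_scattered_pred[OF m \<open>a < m\<close> this]
        have "bwd_jump T m \<in> K" using r T_bounds(2)[OF m] below_b_kappa by auto
        from delta_derivative_jump[OF assms(1)[OF this]] have "h m = h (bwd_jump T m)" using r by simp
        then have "norm (h m - h a) \<le> e * (bwd_jump T m - a)" using below[OF r(1,2)] by simp
        also have "\<dots> \<le> e * (m - a)" using r \<open>e > 0\<close> by simp
        finally show ?thesis .
      next
        case False
        have "m \<in> K"
          using False m b_in_K_iff T_bounds(2)[OF m] below_b_kappa 
          by (cases "m = b") (auto simp: not_le)
        then have "continuous (at m within T) h" 
          using assms(1) delta_differentiable_continuous by blast
        then have lim: "(h \<longlongrightarrow> h m) (at m within {s\<in>T. s < m})"
          unfolding continuous_within by (rule tendsto_within_subset) auto
        have nt: "at m within {s\<in>T. s < m} \<noteq> bot"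
        proof -
          have "m islimpt {s\<in>T. s < m}"
            unfolding islimpt_approachable
          proof (intro allI impI)
            fix d :: real assume "d > 0"
            then obtain s where "s \<in> T" "s < m" "m - d < s" using False
              by (metis diff_less_eq less_add_same_cancel1 not_le)
            then show "\<exists>x'\<in>{s \<in> T. s < m}. x' \<noteq> m \<and> dist x' m < d"
              by (intro bexI[of _ s]) (auto simp: dist_real_def)
          qed
          then show ?thesis by (simp add: trivial_limit_within)
        qed
        show ?thesis
        proof (rule tendsto_le[OF nt])
          show "((\<lambda>s. norm (h s - h a)) \<longlongrightarrow> norm (h m - h a)) (at m within {s\<in>T. s < m})"
            by (intro tendsto_intros lim)
          show "((\<lambda>s. e * (s - a)) \<longlongrightarrow> e * (m - a)) (at m within {s\<in>T. s < m})"
            by (intro tendsto_intros)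
          show "\<forall>\<^sub>F s in at m within {s \<in> T. s < m}. norm (h s - h a) \<le> e * (s - a)"
            using below by (auto simp: eventually_at_filter)
        qed
      qed
    qed simp
    have acc: "\<exists>s\<in>B. m < s \<and> s < m + d" if "d > 0" for d
    proof -
      have "m < m + d" using that by simp
      then obtain s where "s \<in> B" "s < m + d" 
        unfolding m_def using cInf_less_iff[OF ne bd] by blast
      moreover have "m < s" using m_le[OF \<open>s \<in> B\<close>] Pm \<open>s \<in> B\<close> by (cases "m = s") (auto simp: B_def)
      ultimately show ?thesis by auto
    qed
    obtain s where "s \<in> T" "m < s" using acc[of 1] by (auto simp: B_def)
    then have "m \<in> K" using T_bounds(2) m by (intro below_b_kappa) force+
    have rd: "\<sigma> m = m"
      using acc by (intro right_denseI[OF m, unfolded right_dense_def]) 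
        (metis (no_types, lifting) B_def add.commute diff_add_cancel diff_gt_0_iff_gt mem_Collect_eq)
    obtain d where "d > 0" and d: "\<And>s. s \<in> T \<Longrightarrow> \<bar>s - m\<bar> < d \<Longrightarrow>
      norm (h (\<sigma> m) - h s - (\<sigma> m - s) *\<^sub>R 0) \<le> e * \<bar>\<sigma> m - s\<bar>"
      using has_delta_derivativeD[OF assms(1)[OF \<open>m \<in> K\<close>] \<open>e > 0\<close>] by blast
    obtain s where s: "s \<in> B" "m < s" "s < m + d" using acc[OF \<open>d > 0\<close>] by auto
    then have "norm (h s - h m) \<le> e * (s - m)"
      using d[of s] by (auto simp: B_def rd norm_minus_commute)
    then have "norm (h s - h a) \<le> e * (s - m) + e * (m - a)"
      using Pm norm_triangle_ineq[of "h s - h m" "h m - h a"] by simp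
    then show False using s(1) by (simp add: B_def algebra_simps)
  qed
  have "norm (h t - h a) \<le> 0"
  proof (rule field_le_epsilon)
    fix e :: real assume "e > 0"
    have "t - a \<ge> 0" using T_bounds \<open>t \<in> T\<close> by simp
    have "norm (h t - h a) \<le> e / (t - a + 1) * (t - a)"
      using bound[of "e / (t - a + 1)" t] \<open>e > 0\<close> \<open>t \<in> T\<close> \<open>t - a \<ge> 0\<close> by simp
    also have "\<dots> \<le> e" using \<open>e > 0\<close> \<open>t - a \<ge> 0\<close> by (simp add: field_simps)
    finally show "norm (h t - h a) \<le> 0 + e" by simp
  qed
  then show ?thesis by simp
qed

lemma delta_integral_eqI:
  assumes F: "delta_antiderivative T f F" and "c \<in> T" "d \<in> T"
  shows "delta_integral T f c d = F d - F c"
  unfolding delta_integral_def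
proof (rule the_equality)
  show "\<exists>G. delta_antiderivative T f G \<and> F d - F c = G d - G c" using F by blast
next
  fix I assume "\<exists>G. delta_antiderivative T f G \<and> I = G d - G c"
  then obtain G where G: "delta_antiderivative T f G" "I = G d - G c" by blast
  let ?h = "\<lambda>t. F t + (-1) *\<^sub>R G t"
  have "has_delta_derivative T ?h 0 t" if "t \<in> K" for t
    using has_delta_derivative_add[OF _ has_delta_derivative_scaleR, of F "f t" t G "f t" "-1"] F G that
    by (simp add: delta_antiderivative_def)
  then have "?h d = ?h a" "?h c = ?h a"
    using delta_derivative_zero_constant[of ?h] \<open>c \<in> T\<close> \<open>d \<in> T\<close> by blast+
  then have "F d - G d = F c - G c" by simp
  then show "I = F d - F c" using G(2) by (metis add_diff_cancel_right' diff_add_cancel diff_diff_eq2 add.commute)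
qed

end

section \<open>Local bounds on compact sets and integrability of regulated functions\<close>

text \<open>
For bounds that weaken as \<open>n\<close> grows: the largest of the finitely many local indices of a subcover works everywhere.
\<close>
lemma compact_uniform_nat:
  fixes K :: "'m::metric_space set"
  assumes "compact K"
    and local: "\<And>t. t \<in> K \<Longrightarrow> \<exists>d>0. \<exists>n::nat. \<forall>s\<in>K. dist s t < d \<longrightarrow> Q n s"
    and mono: "\<And>m n s. Q m s \<Longrightarrow> m \<le> n \<Longrightarrow> Q n s"
  shows "\<exists>n. \<forall>s\<in>K. Q n s"
proof -
  from local obtain d n where dn: "\<And>t. t \<in> K \<Longrightarrow> d t > 0 \<and> (\<forall>s\<in>K. dist s t < d t \<longrightarrow> Q (n t) s)"
    by metis
  have "K \<subseteq> (\<Union>t\<in>K. ball t (d t))" using dn by force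
  then obtain C where C: "C \<subseteq> K" "finite C" "K \<subseteq> (\<Union>t\<in>C. ball t (d t))"
    using compactE_image[OF assms(1), of K "\<lambda>t. ball t (d t)"] by auto
  have "Q (Max (n ` C)) s" if "s \<in> K" for s
  proof -
    from that C obtain t where t: "t \<in> C" "dist t s < d t" by auto
    then have "Q (n t) s" using dn[of t] C that by (auto simp: dist_commute)
    moreover have "n t \<le> Max (n ` C)" using t C by auto
    ultimately show ?thesis by (rule mono)
  qed
  then show ?thesis by blast
qed

text \<open>
Near each \<open>x\<close> the function is uniformly close to a two-step function built from its one-sided limits.  A tagged division
fine for these neighbourhoods glues the local approximations, and uniform limits of
integrable functions are integrable.
\<close>
lemma regulated_integrable:
  fixes f :: "real \<Rightarrow> 'b::banach"
  assumes left: "\<And>x. a < x \<Longrightarrow> x \<le> b \<Longrightarrow> \<exists>l. (f \<longlongrightarrow> l) (at_left x)"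
    and right: "\<And>x. a \<le> x \<Longrightarrow> x < b \<Longrightarrow> \<exists>l. (f \<longlongrightarrow> l) (at_right x)"
  shows "f integrable_on {a..b}"
proof -
  have "f integrable_on cbox a b"
  proof (rule integrable_uniform_limit)
    fix e :: real assume "e > 0"
    have loc: "\<exists>d>0. \<forall>u v. x \<in> {u..v} \<and> {u..v} \<subseteq> ball x d \<and> {u..v} \<subseteq> {a..b} \<longrightarrow>
       (\<exists>g. (\<forall>z\<in>{u..v}. norm (f z - g z) \<le> e) \<and> g integrable_on {u..v})" if x: "x \<in> {a..b}" for x
    proof -
      have "\<exists>l d. d > 0 \<and> (\<forall>z. a \<le> z \<and> x - d < z \<and> z < x \<longrightarrow> norm (f z - l) \<le> e)"
      proof (cases "a < x")
        case True
        then obtain l where "(f \<longlongrightarrow> l) (at_left x)" using left x by auto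
        then have "eventually (\<lambda>z. dist (f z) l < e) (at_left x)" using \<open>e > 0\<close> by (rule tendstoD)
        then obtain c where "c < x" "\<forall>z>c. z < x \<longrightarrow> dist (f z) l < e"
          unfolding eventually_at_left_field by auto
        then show ?thesis 
          by (intro exI[of _ l] exI[of _ "x - c"]) (auto simp: dist_norm less_imp_le)
      qed (auto intro: exI[of _ 1])
      then obtain l dl where l: "dl > 0" "\<And>z. a \<le> z \<Longrightarrow> x - dl < z \<Longrightarrow> z < x \<Longrightarrow> norm (f z - l) \<le> e"
        by blast
      have "\<exists>r d. d > 0 \<and> (\<forall>z. z \<le> b \<and> x < z \<and> z < x + d \<longrightarrow> norm (f z - r) \<le> e)"
      proof (cases "x < b")
        case True
        then obtain r where "(f \<longlongrightarrow> r) (at_right x)" using right x by auto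
        then have "eventually (\<lambda>z. dist (f z) r < e) (at_right x)" using \<open>e > 0\<close> by (rule tendstoD)
        then obtain c where "c > x" "\<forall>z>x. z < c \<longrightarrow> dist (f z) r < e"
          unfolding eventually_at_right_field by auto
        then show ?thesis 
          by (intro exI[of _ r] exI[of _ "c - x"]) (auto simp: dist_norm less_imp_le)
      qed (auto intro: exI[of _ 1])
      then obtain r dr where r: "dr > 0" "\<And>z. z \<le> b \<Longrightarrow> x < z \<Longrightarrow> z < x + dr \<Longrightarrow> norm (f z - r) \<le> e"
        by blast
      define g where "g z = (if z < x then l else if x < z then r else f x)" for z
      have "\<exists>g. (\<forall>z\<in>{u..v}. norm (f z - g z) \<le> e) \<and> g integrable_on {u..v}"
        if uv: "x \<in> {u..v}" "{u..v} \<subseteq> ball x (min dl dr)" "{u..v} \<subseteq> {a..b}" for u v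
      proof (intro exI conjI ballI)
        fix z assume z: "z \<in> {u..v}"
        then have "dist x z < min dl dr" "z \<in> {a..b}" using uv by auto
        then show "norm (f z - g z) \<le> e"
          using l(2)[of z] r(2)[of z] \<open>e > 0\<close> by (auto simp: g_def dist_real_def)
      next
        have "g integrable_on {u..x}"
          by (rule integrable_spike[where f = "\<lambda>_. l" and S = "{x}"]) (auto simp: g_def)
        moreover have "g integrable_on {x..v}"
          by (rule integrable_spike[where f = "\<lambda>_. r" and S = "{x}"]) (auto simp: g_def)
        ultimately show "g integrable_on {u..v}"
          using uv by (intro Henstock_Kurzweil_Integration.integrable_combine[of u x v]) auto
      qed
      then show ?thesis using l(1) r(1) by (intro exI[of _ "min dl dr"]) auto
    qed
    then obtain d where d: "\<And>x. x \<in> {a..b} \<Longrightarrow> d x > 0"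
      "\<And>x u v. x \<in> {a..b} \<Longrightarrow> x \<in> {u..v} \<Longrightarrow> {u..v} \<subseteq> ball x (d x) \<Longrightarrow> {u..v} \<subseteq> {a..b} \<Longrightarrow>
         (\<exists>g. (\<forall>z\<in>{u..v}. norm (f z - g z) \<le> e) \<and> g integrable_on {u..v})" by metis
    have "gauge (\<lambda>x. ball x (if x \<in> {a..b} then d x else 1))" using d(1) by (intro gauge_ball_dependent) auto
    then obtain p where p: "p tagged_division_of cbox a b" "(\<lambda>x. ball x (if x \<in> {a..b} then d x else 1)) fine p"
      by (rule fine_division_exists)
    have "\<forall>i\<in>snd ` p. \<exists>g. (\<forall>x\<in>i. norm (f x - g x) \<le> e) \<and> g integrable_on i"
    proof safe
      fix x k assume xk: "(x, k) \<in> p"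
      obtain u v where k: "k = cbox u v" using tagged_division_ofD(4)[OF p(1) xk] by auto
      have "x \<in> k" "k \<subseteq> {a..b}" using tagged_division_ofD(2,3)[OF p(1) xk] by auto
      moreover have "k \<subseteq> ball x (if x \<in> {a..b} then d x else 1)" using fineD[OF p(2) xk] .
      ultimately show "\<exists>g. (\<forall>x\<in>snd (x, k). norm (f x - g x) \<le> e) \<and> g integrable_on snd (x, k)"
        using d(2)[of x u v] k by (auto simp del: ball_eq_ball_iff split: if_splits)
    qed
    from approximable_on_division[OF less_imp_le[OF \<open>e > 0\<close>] division_of_tagged_division[OF p(1)] this]
    show "\<exists>g. (\<forall>x\<in>cbox a b. norm (f x - g x) \<le> e) \<and> g integrable_on cbox a b" by metis
  qed
  then show ?thesis by simp
qed

context compact_time_scale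
begin

section \<open>Rd-continuity as existence of a limit\<close>

text \<open>
At a right-scattered point of K no other points of K lie close to the right, and at a left-scattered point none
close to the left.  Hence the clauses of rd-continuity combine into one two-sided limit within K, which makes
closure properties and compositions immediate.
\<close>
lemma rd_continuous_on_iff:
  "rd_continuous_on T K f \<longleftrightarrow> (\<forall>t\<in>K. (\<exists>l. (f \<longlongrightarrow> l) (at t within K)) \<and>
      (right_dense T t \<longrightarrow> (f \<longlongrightarrow> f t) (at t within K)))" (is "?L \<longleftrightarrow> ?R")
proof
  assume L: ?L
  show ?R
  proof
    fix t assume t: "t \<in> K"
    show "(\<exists>l. (f \<longlongrightarrow> l) (at t within K)) \<and> (right_dense T t \<longrightarrow> (f \<longlongrightarrow> f t) (at t within K))"
    proof (cases "right_dense T t")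
      case True
      then show ?thesis using L t by (auto simp: rd_continuous_on_def continuous_within)
    next
      case False
      note rs = right_scattered_nhd[OF t False]
      have eq: "at t within K = at t within {s \<in> K. s < t}"
        using rs by (intro at_within_nhd[where S = "{..<\<sigma> t}"]) (auto simp: order_le_less)
      have "\<exists>l. (f \<longlongrightarrow> l) (at t within {s \<in> K. s < t})"
      proof (cases "left_dense T t")
        case True
        then show ?thesis using L t by (auto simp: rd_continuous_on_def)
      next
        case False
        then obtain u where u: "u < t" "\<And>s. s \<in> K \<Longrightarrow> u < s \<Longrightarrow> t \<le> s"
          using left_scattered_nhd[OF t] by blast
        have "at t within {s \<in> K. s < t} = at t within {}"
          using u by (intro at_within_nhd[where S = "{u<..}"]) force+
        then show ?thesis by simp
      qed
      then show ?thesis using False eq by simp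
    qed
  qed
next
  assume R: ?R
  show ?L unfolding rd_continuous_on_def continuous_within
  proof safe
    fix t assume t: "t \<in> K"
    show "right_dense T t \<Longrightarrow> (f \<longlongrightarrow> f t) (at t within K)" using R t by auto
    obtain l where "(f \<longlongrightarrow> l) (at t within K)" using R t by auto
    then have "(f \<longlongrightarrow> l) (at t within {s \<in> K. s < t})" by (rule tendsto_within_subset) auto
    then show "\<exists>l. (f \<longlongrightarrow> l) (at t within {s \<in> K. s < t})" ..
  qed
qed

lemma rd_continuous_limit:
  assumes "rd_continuous_on T K f" "t \<in> K"
  obtains l where "(f \<longlongrightarrow> l) (at t within K)" "right_dense T t \<Longrightarrow> l = f t"
  using assms unfolding rd_continuous_on_iff by (cases "right_dense T t") auto

lemma rd_continuousI:
  assumes "\<And>t. t \<in> K \<Longrightarrow> \<exists>l. (f \<longlongrightarrow> l) (at t within K) \<and> (right_dense T t \<longrightarrow> l = f t)"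
  shows "rd_continuous_on T K f"
  unfolding rd_continuous_on_iff using assms by metis

lemma rd_continuous_binop:
  assumes "rd_continuous_on T K f" "rd_continuous_on T K g"
    and h: "\<And>x y. (\<lambda>(x, y). h x y) \<midarrow>(x, y)\<rightarrow> h x y"
  shows "rd_continuous_on T K (\<lambda>t. h (f t) (g t))"
proof (rule rd_continuousI)
  fix t assume t: "t \<in> K"
  obtain l where l: "(f \<longlongrightarrow> l) (at t within K)" "right_dense T t \<Longrightarrow> l = f t"
    using rd_continuous_limit[OF assms(1) t] by blast
  obtain m where m: "(g \<longlongrightarrow> m) (at t within K)" "right_dense T t \<Longrightarrow> m = g t"
    using rd_continuous_limit[OF assms(2) t] by blast
  have "isCont (\<lambda>(x, y). h x y) (l, m)" using h[of l m] by (simp add: isCont_def)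
  from isCont_tendsto_compose[OF this tendsto_Pair[OF l(1) m(1)]]
  have "((\<lambda>t. h (f t) (g t)) \<longlongrightarrow> h l m) (at t within K)" by simp
  then show "\<exists>l. ((\<lambda>t. h (f t) (g t)) \<longlongrightarrow> l) (at t within K) \<and> (right_dense T t \<longrightarrow> l = h (f t) (g t))"
    using l m by (intro exI[of _ "h l m"]) auto
qed

lemma rd_continuous_add:
  assumes "rd_continuous_on T K f" "rd_continuous_on T K g"
  shows "rd_continuous_on T K (\<lambda>t. f t + g t)"
  by (rule rd_continuous_binop[OF assms]) (auto simp: case_prod_unfold intro!: tendsto_eq_intros)

lemma rd_continuous_diff:
  assumes "rd_continuous_on T K f" "rd_continuous_on T K g"
  shows "rd_continuous_on T K (\<lambda>t. f t - g t)"
  by (rule rd_continuous_binop[OF assms]) (auto simp: case_prod_unfold intro!: tendsto_eq_intros)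

lemma rd_continuous_inner:
  fixes f g :: "real \<Rightarrow> 'a::real_inner"
  assumes "rd_continuous_on T K f" "rd_continuous_on T K g"
  shows "rd_continuous_on T K (\<lambda>t. f t \<bullet> g t)"
  by (rule rd_continuous_binop[OF assms]) (auto simp: case_prod_unfold intro!: tendsto_eq_intros)

lemma continuous_imp_rd_continuous:
  assumes "\<And>t. t \<in> K \<Longrightarrow> continuous (at t within K) f"
  shows "rd_continuous_on T K f"
  using assms by (intro rd_continuousI) (auto simp: continuous_within)

lemma rd_continuous_const: "rd_continuous_on T K (\<lambda>t. c)"
  by (rule continuous_imp_rd_continuous) simp

lemma rd_continuous_scaleR:
  assumes "rd_continuous_on T K f"
  shows "rd_continuous_on T K (\<lambda>t. r *\<^sub>R f t)"
  by (rule rd_continuous_binop[OF rd_continuous_const[of r] assms, where h = scaleR]) 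
     (auto simp: case_prod_unfold intro!: tendsto_eq_intros)

lemma rd_continuous_cong:
  assumes "\<And>t. t \<in> K \<Longrightarrow> f t = g t"
  shows "rd_continuous_on T K f \<longleftrightarrow> rd_continuous_on T K g"
proof -
  have "(f \<longlongrightarrow> l) (at t within K) \<longleftrightarrow> (g \<longlongrightarrow> l) (at t within K)" for l t
    using assms by (intro filterlim_cong) (auto simp: eventually_at_filter)
  then show ?thesis unfolding rd_continuous_on_iff using assms by simp
qed

lemma delta_differentiable_rd_continuous:
  assumes "\<And>t. t \<in> K \<Longrightarrow> has_delta_derivative T f (D t) t"
  shows "rd_continuous_on T K f"
  using assms kappa_in_T
  by (intro continuous_imp_rd_continuous) (blast intro: continuous_within_subset delta_differentiable_continuous)

lemma rd_continuous_bounded: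
  assumes "rd_continuous_on T K f"
  shows "\<exists>B. \<forall>t\<in>K. norm (f t) \<le> B"
proof -
  have "\<exists>n::nat. \<forall>s\<in>K. norm (f s) \<le> real n"
  proof (rule compact_uniform_nat[OF compact_K])
    fix t assume t: "t \<in> K"
    obtain l where "(f \<longlongrightarrow> l) (at t within K)" using rd_continuous_limit[OF assms t] by blast
    then have "eventually (\<lambda>s. dist (f s) l < 1) (at t within K)" by (rule tendstoD) simp
    then obtain d where d: "d > 0" "\<And>s. s \<in> K \<Longrightarrow> s \<noteq> t \<Longrightarrow> dist s t < d \<Longrightarrow> dist (f s) l < 1"
      unfolding eventually_at by auto
    obtain n :: nat where n: "max (norm (f t)) (norm l + 1) \<le> real n" using real_arch_simple by blast
    have "norm (f s) \<le> real n" if "s \<in> K" "dist s t < d" for s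
    proof (cases "s = t")
      case False
      then have "norm (f s - l) < 1" using d that by (auto simp: dist_norm)
      then show ?thesis using n norm_triangle_ineq2[of "f s" l] by linarith
    qed (use n in auto)
    then show "\<exists>d>0. \<exists>n::nat. \<forall>s\<in>K. dist s t < d \<longrightarrow> norm (f s) \<le> real n" using d(1) by blast
  qed auto
  then show ?thesis by blast
qed

text \<open>
On the left of \<open>t\<close> the value \<open>\<sigma>(s)\<close> is caught between \<open>s\<close> and \<open>t\<close>; on the right it is caught below any point of T
beyond \<open>s\<close>, and such points are arbitrarily close to \<open>t\<close> unless K has no points just to the right of \<open>t\<close>.  At a
right-scattered \<open>t\<close> the limit \<open>t\<close> differs from \<open>\<sigma>(t)\<close>.
\<close>
lemma fwd_jump_tendsto:
  assumes "t \<in> K"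
  shows "(\<sigma> \<longlongrightarrow> t) (at t within K)"
proof (rule tendstoI)
  fix e :: real assume "e > 0"
  have tT: "t \<in> T" using assms kappa_in_T by simp
  have "\<exists>u>t. \<forall>s\<in>K. t < s \<and> s < u \<longrightarrow> \<sigma> s < t + e"
  proof (cases "right_dense T t \<and> t < b")
    case True
    then obtain u where "u \<in> T" "t < u" "u < t + e"
      using right_dense_approx[OF tT _ _, of "t + e"] \<open>e > 0\<close> by auto
    then show ?thesis using fwd_jump_le kappa_in_T by (intro exI[of _ u]) force
  next
    case False
    have "\<exists>u>t. \<forall>s\<in>T. s \<le> t \<or> u \<le> s"
    proof (cases "t < b")
      case True
      then have "t < \<sigma> t" using False fwd_jump_ge[OF tT] by (auto simp: right_dense_def)
      then show ?thesis using fwd_jump_le[OF tT] by (intro exI[of _ "\<sigma> t"]) (meson linorder_not_less)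
    next
      case False
      then show ?thesis using T_bounds by (intro exI[of _ "t + 1"]) force
    qed
    then show ?thesis using kappa_in_T by force
  qed
  then obtain u where u: "t < u" "\<And>s. s \<in> K \<Longrightarrow> t < s \<Longrightarrow> s < u \<Longrightarrow> \<sigma> s < t + e" by blast
  have "dist (\<sigma> s) t < e" if s: "s \<in> K" "s \<noteq> t" "dist s t < min e (u - t)" for s
  proof (cases "s < t")
    case True
    then show ?thesis 
      using fwd_jump_le[OF kappa_in_T[OF s(1)] tT] fwd_jump_ge[OF kappa_in_T[OF s(1)]] s
      by (auto simp: dist_real_def)
  next
    case False
    then show ?thesis 
      using u(2)[of s] fwd_jump_ge[OF kappa_in_T[OF s(1)]] s by (auto simp: dist_real_def)
  qed
  then show "\<forall>\<^sub>F s in at t within K. dist (\<sigma> s) t < e"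
    unfolding eventually_at using \<open>e > 0\<close> u(1) by (intro exI[of _ "min e (u - t)"]) auto
qed

lemma rd_continuous_compose_fwd_jump:
  assumes "continuous_on {a..b} F"
  shows "rd_continuous_on T K (\<lambda>t. F (\<sigma> t))"
proof (rule rd_continuousI)
  fix t assume t: "t \<in> K"
  have "((\<lambda>t. F (\<sigma> t)) \<longlongrightarrow> F t) (at t within K)"
  proof (rule continuous_within_tendsto_compose[OF _ _ fwd_jump_tendsto[OF t]])
    show "continuous (at t within {a..b}) F"
      using assms t K_subset by (auto simp: continuous_on_eq_continuous_within)
    show "\<forall>\<^sub>F s in at t within K. \<sigma> s \<in> {a..b}"
      using kappa_in_T fwd_jump_in T_bounds by (auto simp: eventually_at_filter)
  qed
  then show "\<exists>l. ((\<lambda>t. F (\<sigma> t)) \<longlongrightarrow> l) (at t within K) \<and> (right_dense T t \<longrightarrow> l = F (\<sigma> t))"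
    by (intro exI[of _ "F t"]) (simp add: right_dense_def)
qed

section \<open>The delta integral as an ordinary integral\<close>

text \<open>
The projection uses K and not T, so that functions on K extend to all of \<open>[a, b]\<close>, including \<open>b\<close> when \<open>b\<close> is
left-scattered.
\<close>
definition floor_K :: "real \<Rightarrow> real" where
  "floor_K x = Sup {s \<in> K. s \<le> x}"

lemma floor_K_props:
  assumes "a \<le> x"
  shows floor_K_in: "floor_K x \<in> K" and floor_K_le: "floor_K x \<le> x"
    and floor_K_ge: "\<And>s. s \<in> K \<Longrightarrow> s \<le> x \<Longrightarrow> s \<le> floor_K x"
proof -
  have eq: "{s \<in> K. s \<le> x} = K \<inter> {..x}" by auto
  have "Sup {s \<in> K. s \<le> x} \<in> {s \<in> K. s \<le> x}"
    using a_in_K assms closed_K K_subset by (intro closed_subset_Sup_mem) (auto simp: eq)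
  then show "floor_K x \<in> K" "floor_K x \<le> x" by (auto simp: floor_K_def)
  show "\<And>s. s \<in> K \<Longrightarrow> s \<le> x \<Longrightarrow> s \<le> floor_K x"
    unfolding floor_K_def by (rule cSup_upper) (auto intro!: bdd_aboveI)
qed

lemma floor_K_eqI:
  assumes "t \<in> K" "t \<le> x" "\<And>s. s \<in> K \<Longrightarrow> s \<le> x \<Longrightarrow> s \<le> t"
  shows "floor_K x = t"
proof -
  have "a \<le> x" using assms K_subset by fastforce
  then show ?thesis using floor_K_props[of x] assms by (meson order_antisym)
qed

text \<open>
Either K has a gap to the left of \<open>x\<close>, where the projection is constant, or \<open>x\<close> is left-dense and the projection
tends to \<open>x\<close> inside K.  In both cases composing with an rd-continuous function gives a left limit.
\<close>
lemma floor_K_left: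
  assumes "a < x"
  shows "(\<exists>c\<in>K. eventually (\<lambda>z. floor_K z = c) (at_left x)) \<or>
         (x \<in> K \<and> filterlim floor_K (at x within K) (at_left x))"
proof (cases "\<exists>u<x. \<forall>s\<in>K. s < x \<longrightarrow> s \<le> u")
  case True
  then obtain u where u: "u < x" "\<And>s. s \<in> K \<Longrightarrow> s < x \<Longrightarrow> s \<le> u" by auto
  let ?u = "max a u"
  have "floor_K z = floor_K ?u" if "z \<in> {?u<..<x}" for z
    using that u floor_K_props[of ?u] by (intro floor_K_eqI) force+
  then have "eventually (\<lambda>z. floor_K z = floor_K ?u) (at_left x)"
    using u assms by (intro eventually_at_leftI[of ?u]) auto
  then show ?thesis using floor_K_in[of ?u] by auto
next
  case False
  then have acc: "\<exists>s\<in>K. u < s \<and> s < x" if "u < x" for u using that by (meson not_le)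
  have "x \<in> closure K"
    unfolding closure_approachable
  proof (intro allI impI)
    fix e :: real assume "e > 0"
    then obtain s where "s \<in> K" "x - e < s" "s < x" using acc[of "x - e"] by auto
    then show "\<exists>y\<in>K. dist y x < e" by (intro bexI[of _ s]) (auto simp: dist_real_def)
  qed
  then have "x \<in> K" using closed_K by simp
  moreover have "filterlim floor_K (at x within K) (at_left x)"
  proof -
    have "(floor_K \<longlongrightarrow> x) (at_left x)"
    proof (rule tendstoI)
      fix e :: real assume "e > 0"
      then obtain s where s: "s \<in> K" "x - e < s" "s < x" using acc[of "x - e"] by auto
      have "dist (floor_K z) x < e" if "z \<in> {s<..<x}" for z
      proof -
        have "a \<le> z" using s K_subset that by force
        then show ?thesis using floor_K_ge[of z s] floor_K_le[of z] s that by (auto simp: dist_real_def)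
      qed
      then show "eventually (\<lambda>z. dist (floor_K z) x < e) (at_left x)"
        using s by (intro eventually_at_leftI[of s]) auto
    qed
    moreover have "eventually (\<lambda>z. floor_K z \<in> K \<and> floor_K z \<noteq> x) (at_left x)"
    proof (rule eventually_at_leftI[OF _ assms])
      fix z assume "z \<in> {a<..<x}"
      then show "floor_K z \<in> K \<and> floor_K z \<noteq> x" using floor_K_in[of z] floor_K_le[of z] by auto
    qed
    ultimately show ?thesis by (simp add: filterlim_at)
  qed
  ultimately show ?thesis by blast
qed

lemma floor_K_right:
  assumes "a \<le> x"
  shows "(\<exists>c\<in>K. eventually (\<lambda>z. floor_K z = c) (at_right x)) \<or>
         (x \<in> K \<and> right_dense T x \<and> (floor_K \<longlongrightarrow> x) (at_right x))"
proof (cases "\<exists>u>x. \<forall>s\<in>K. x < s \<longrightarrow> u \<le> s")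
  case True
  then obtain u where u: "x < u" "\<And>s. s \<in> K \<Longrightarrow> x < s \<Longrightarrow> u \<le> s" by auto
  have "floor_K z = floor_K x" if "z \<in> {x<..<u}" for z
    using that u floor_K_props[of x] assms by (intro floor_K_eqI) force+
  then have "eventually (\<lambda>z. floor_K z = floor_K x) (at_right x)"
    using u assms by (intro eventually_at_rightI[of x u]) auto
  then show ?thesis using floor_K_in[of x] assms by auto
next
  case False
  then have acc: "\<exists>s\<in>K. x < s \<and> s < u" if "x < u" for u using that by (meson not_le)
  have "x \<in> closure K"
    unfolding closure_approachable
  proof (intro allI impI)
    fix e :: real assume "e > 0"
    then obtain s where "s \<in> K" "x < s" "s < x + e" using acc[of "x + e"] by auto
    then show "\<exists>y\<in>K. dist y x < e" by (intro bexI[of _ s]) (auto simp: dist_real_def)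
  qed
  then have x: "x \<in> K" using closed_K by simp
  moreover have "right_dense T x" using x acc kappa_in_T by (intro right_denseI) blast+
  moreover have "(floor_K \<longlongrightarrow> x) (at_right x)"
  proof (rule tendstoI)
    fix e :: real assume "e > 0"
    have "dist (floor_K z) x < e" if "z \<in> {x<..<x + e}" for z
      using that assms floor_K_ge[of z x] floor_K_le[of z] x by (auto simp: dist_real_def)
    then show "eventually (\<lambda>z. dist (floor_K z) x < e) (at_right x)"
      using \<open>e > 0\<close> by (intro eventually_at_rightI[of x "x + e"]) auto
  qed
  ultimately show ?thesis by blast
qed

lemma rd_continuous_integrable:
  fixes f :: "real \<Rightarrow> 'b::banach"
  assumes "rd_continuous_on T K f"
  shows "(\<lambda>x. f (floor_K x)) integrable_on {a..b}"
proof (rule regulated_integrable)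
  fix x assume x: "a < x"
  show "\<exists>l. ((\<lambda>x. f (floor_K x)) \<longlongrightarrow> l) (at_left x)"
    using floor_K_left[OF x]
  proof (elim disjE bexE conjE)
    fix c assume "eventually (\<lambda>z. floor_K z = c) (at_left x)"
    then have "eventually (\<lambda>z. f (floor_K z) = f c) (at_left x)" by (rule eventually_mono) simp
    then show ?thesis by (intro exI tendsto_eventually)
  next
    assume "x \<in> K" and lim: "filterlim floor_K (at x within K) (at_left x)"
    obtain l where "(f \<longlongrightarrow> l) (at x within K)" using rd_continuous_limit[OF assms \<open>x \<in> K\<close>] by blast
    from filterlim_compose[OF this lim] show ?thesis by blast
  qed
next
  fix x assume x: "a \<le> x"
  show "\<exists>l. ((\<lambda>x. f (floor_K x)) \<longlongrightarrow> l) (at_right x)"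
    using floor_K_right[OF x]
  proof (elim disjE bexE conjE)
    fix c assume "eventually (\<lambda>z. floor_K z = c) (at_right x)"
    then have "eventually (\<lambda>z. f (floor_K z) = f c) (at_right x)" by (rule eventually_mono) simp
    then show ?thesis by (intro exI tendsto_eventually)
  next
    assume xK: "x \<in> K" "right_dense T x" and lim: "(floor_K \<longlongrightarrow> x) (at_right x)"
    have "continuous (at x within K) f"
      using assms xK by (simp add: rd_continuous_on_def)
    moreover have "eventually (\<lambda>z. floor_K z \<in> K) (at_right x)"
      using floor_K_in x by (auto simp: eventually_at_filter intro!: always_eventually)
    ultimately show ?thesis using continuous_within_tendsto_compose[OF _ _ lim] by blast
  qed
qed

definition primitive :: "(real \<Rightarrow> 'b::banach) \<Rightarrow> real \<Rightarrow> 'b" where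
  "primitive f t = integral {a..t} (\<lambda>x. f (floor_K x))"

lemma primitive_a [simp]: "primitive f a = 0"
  by (simp add: primitive_def)

lemma primitive_diff:
  assumes "rd_continuous_on T K f" "a \<le> u" "u \<le> v" "v \<le> b"
  shows "primitive f v - primitive f u = integral {u..v} (\<lambda>x. f (floor_K x))"
proof -
  have "(\<lambda>x. f (floor_K x)) integrable_on {a..v}"
    using rd_continuous_integrable[OF assms(1)] assms by (auto intro: integrable_on_subinterval)
  from Henstock_Kurzweil_Integration.integral_combine[OF assms(2,3) this]
  show ?thesis by (simp add: primitive_def algebra_simps)
qed

lemma primitive_continuous:
  assumes "rd_continuous_on T K f"
  shows "continuous_on {a..b} (primitive f)"
  unfolding primitive_def
  using indefinite_integral_continuous_1[OF rd_continuous_integrable[OF assms]] .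

text \<open>
On the gap \<open>[t, \<sigma>(t))\<close> the projection onto K is constantly \<open>t\<close>; the right end of the gap is a null set.
\<close>
lemma primitive_jump:
  assumes f: "rd_continuous_on T K f" and t: "t \<in> K"
  shows "primitive f (\<sigma> t) - primitive f t = (\<sigma> t - t) *\<^sub>R f t"
proof -
  have tT: "t \<in> T" using t kappa_in_T by simp
  have "integral {t..\<sigma> t} (\<lambda>x. f (floor_K x)) = integral {t..\<sigma> t} (\<lambda>x. f t)"
  proof (rule integral_spike[where S = "{\<sigma> t}"])
    fix x assume x: "x \<in> {t..\<sigma> t} - {\<sigma> t}"
    then have "floor_K x = t" using t fwd_jump_le[OF tT] kappa_in_T 
      by (intro floor_K_eqI) (force simp: not_le)+
    then show "f t = f (floor_K x)" by simp
  qed simp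
  then show ?thesis
    using primitive_diff[OF f, of t "\<sigma> t"] fwd_jump_ge[OF tT] T_bounds tT fwd_jump_in[OF tT] by simp
qed

text \<open>
At a right-dense point \<open>f\<close> is continuous within K, and between \<open>t\<close> and \<open>s\<close> the projection stays between \<open>t\<close> and \<open>s\<close>,
so the classical mean value estimate applies.  At a right-scattered point the jump formula is exact and
continuity of the integral absorbs the rest, since \<open>|\<sigma>(t) - s| \<ge> \<mu>(t) > 0\<close> for the \<open>s\<close> that are close to \<open>t\<close>.
\<close>
theorem primitive_antiderivative:
  fixes f :: "real \<Rightarrow> 'b::banach"
  assumes f: "rd_continuous_on T K f"
  shows "delta_antiderivative T f (primitive f)"
  unfolding delta_antiderivative_def
proof
  fix t assume t: "t \<in> K"
  have tT: "t \<in> T" using t kappa_in_T by simp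
  let ?P = "primitive f"
  show "has_delta_derivative T ?P (f t) t"
  proof (rule has_delta_derivativeI[OF t])
    fix e :: real assume "e > 0"
    show "\<exists>\<delta>>0. \<forall>s\<in>T. \<bar>s - t\<bar> < \<delta> \<longrightarrow>
        norm (?P (\<sigma> t) - ?P s - (\<sigma> t - s) *\<^sub>R f t) \<le> e * \<bar>\<sigma> t - s\<bar>"
    proof (cases "right_dense T t")
      case True
      then have st: "\<sigma> t = t" by (simp add: right_dense_def)
      have "continuous (at t within K) f" using f t True by (simp add: rd_continuous_on_def)
      then obtain d where d: "d > 0" "\<And>s. s \<in> K \<Longrightarrow> dist s t < d \<Longrightarrow> dist (f s) (f t) < e"
        using \<open>e > 0\<close> unfolding continuous_within_eps_delta by metis
      (* Stated for u \<le> v, so that it serves for s on either side of t. *)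
      have seg: "norm (?P v - ?P u - (v - u) *\<^sub>R f t) \<le> e * (v - u)"
        if uv: "u \<in> K" "u \<le> v" "v \<in> T" "\<And>z. u \<le> z \<Longrightarrow> z \<le> v \<Longrightarrow> \<bar>z - t\<bar> < d" for u v
      proof -
        have ab: "a \<le> u" "v \<le> b" using uv K_subset T_bounds by auto
        have int: "(\<lambda>x. f (floor_K x)) integrable_on {u..v}"
          using rd_continuous_integrable[OF f] ab by (auto intro: integrable_on_subinterval)
        have "?P v - ?P u - (v - u) *\<^sub>R f t = integral {u..v} (\<lambda>x. f (floor_K x) - f t)"
          using primitive_diff[OF f ab(1) uv(2) ab(2)] uv(2)
            Henstock_Kurzweil_Integration.integral_diff[OF int integrable_const_ivl[of "f t"]]
          by simp
        moreover have "norm (integral {u..v} (\<lambda>x. f (floor_K x) - f t)) \<le> e * (v - u)"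
        proof -
          have "norm (f (floor_K x) - f t) \<le> e" if "x \<in> {u..v}" for x
          proof -
            have "a \<le> x" using ab that by simp
            note fl = floor_K_props[OF this]
            have "dist (floor_K x) t < d"
              using uv(4)[of "floor_K x"] fl uv(1) that by (auto simp: dist_real_def)
            then show ?thesis using d(2)[OF fl(1)] by (simp add: dist_norm less_imp_le)
          qed
          then show ?thesis
            using integrable_bound[of e "\<lambda>x. f (floor_K x) - f t" u v] uv(2) \<open>e > 0\<close>
              integrable_diff[OF int integrable_const_ivl[of "f t"]]
            by simp
        qed
        ultimately show ?thesis by simp
      qed
      have "norm (?P (\<sigma> t) - ?P s - (\<sigma> t - s) *\<^sub>R f t) \<le> e * \<bar>\<sigma> t - s\<bar>"
        if s: "s \<in> T" "\<bar>s - t\<bar> < d" for s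
      proof (cases "s \<le> t")
        case True
        then show ?thesis using seg[of s t] kappa_down[OF s(1) True t] s tT by (auto simp: st)
      next
        case False
        then have "norm (?P s - ?P t - (s - t) *\<^sub>R f t) \<le> e * (s - t)" using seg[of t s] t s by auto
        moreover have "?P t - ?P s - (t - s) *\<^sub>R f t = - (?P s - ?P t - (s - t) *\<^sub>R f t)"
          by (simp add: algebra_simps)
        ultimately show ?thesis using False unfolding st by (metis abs_minus_commute abs_of_pos diff_gt_0_iff_gt norm_minus_cancel not_le)
      qed
      then show ?thesis using d(1) by blast
    next
      case False
      then have mu: "\<sigma> t - t > 0" using fwd_jump_ge[OF tT] by (auto simp: right_dense_def)
      let ?m = "\<sigma> t - t"
      let ?r = "\<lambda>s. ?P t - ?P s - (t - s) *\<^sub>R f t"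
      have "continuous_on T ?P" using primitive_continuous[OF f] T_subset by (rule continuous_on_subset)
      then have "(?P \<longlongrightarrow> ?P t) (at t within T)" using tT by (simp add: continuous_on_def)
      then have "(?r \<longlongrightarrow> ?P t - ?P t - (t - t) *\<^sub>R f t) (at t within T)"
        by (intro tendsto_intros)
      then have "eventually (\<lambda>s. dist (?r s) 0 < e * ?m) (at t within T)"
        using \<open>e > 0\<close> mu by (intro tendstoD) auto
      then obtain d where d: "d > 0" "\<And>s. s \<in> T \<Longrightarrow> s \<noteq> t \<Longrightarrow> dist s t < d \<Longrightarrow> norm (?r s) < e * ?m"
        unfolding eventually_at by auto
      have "norm (?P (\<sigma> t) - ?P s - (\<sigma> t - s) *\<^sub>R f t) \<le> e * \<bar>\<sigma> t - s\<bar>"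
        if s: "s \<in> T" "\<bar>s - t\<bar> < min d ?m" for s
      proof -
        have "s < \<sigma> t" using s by auto
        then have "s \<le> t" using fwd_jump_le[OF tT s(1)] by (meson linorder_not_less)
        have eq: "?P (\<sigma> t) - ?P s - (\<sigma> t - s) *\<^sub>R f t = ?r s"
          using primitive_jump[OF f t] by (simp add: algebra_simps)
        have "norm (?r s) \<le> e * ?m"
          using d(2)[of s] s \<open>e > 0\<close> mu by (cases "s = t") (auto simp: dist_real_def)
        moreover have "e * ?m \<le> e * \<bar>\<sigma> t - s\<bar>" using \<open>s \<le> t\<close> mu \<open>e > 0\<close> by simp
        ultimately show ?thesis unfolding eq by (rule order_trans)
      qed
      then show ?thesis using d(1) mu by (intro exI[of _ "min d ?m"]) auto
    qed
  qed
qed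

lemma delta_integral_primitive:
  assumes "rd_continuous_on T K f" "t \<in> T"
  shows "delta_integral T f a t = primitive f t"
  using delta_integral_eqI[OF primitive_antiderivative[OF assms(1)] a_in_T assms(2)] by simp

text \<open>
The primitive is increasing with equal values at both ends, hence zero on T, and \<open>f\<close> is its delta derivative.
Uniqueness of that derivative replaces a case distinction between dense and scattered points.
\<close>
lemma primitive_nonneg_zero:
  fixes f :: "real \<Rightarrow> real"
  assumes f: "rd_continuous_on T K f" and nonneg: "\<And>t. t \<in> K \<Longrightarrow> f t \<ge> 0"
    and zero: "primitive f b = 0" and t: "t \<in> K"
  shows "f t = 0"
proof -
  have nn: "integral {u..v} (\<lambda>x. f (floor_K x)) \<ge> 0" if "a \<le> u" "v \<le> b" for u v
    using that rd_continuous_integrable[OF f] nonneg floor_K_in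
    by (intro integral_nonneg) (auto intro: integrable_on_subinterval)
  have P0: "primitive f s = 0" if "s \<in> T" for s
    using primitive_diff[OF f, of s b] nn[of s b] nn[of a s] T_bounds[OF that] zero
    by (simp add: primitive_def)
  have "has_delta_derivative T (primitive f) (f t) t"
    using primitive_antiderivative[OF f] t by (simp add: delta_antiderivative_def)
  then have "has_delta_derivative T (\<lambda>s. 0) (f t) t"
    using P0 fwd_jump_in[OF kappa_in_T[OF t]] by (simp add: has_delta_derivative_def)
  then show ?thesis using delta_derivative_unique has_delta_derivative_const[OF t] by blast
qed

end

section \<open>Gradients of the Lagrangian\<close>

lemma gradient_eq:
  assumes "GDERIV f x :> D"
  shows "gradient f x = D"
  unfolding gradient_def
proof (rule the_equality)
  show "GDERIV f x :> D" by (fact assms)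
next
  fix E assume "GDERIV f x :> E"
  then have "(\<lambda>h. h \<bullet> E) = (\<lambda>h. h \<bullet> D)" using assms has_derivative_unique unfolding gderiv_def by blast
  then show "E = D" by (metis vector_eq_ldot)
qed

lemma gradient_of_has_derivative:
  fixes f :: "'a::euclidean_space \<Rightarrow> real"
  assumes "(f has_derivative f') (at x)"
  shows gradient_sum_Basis: "gradient f x = (\<Sum>b\<in>Basis. f' b *\<^sub>R b)"
    and derivative_inner_gradient: "f' h = h \<bullet> gradient f x"
proof -
  interpret linear f' using assms by (rule has_derivative_linear)
  have inner: "f' h = h \<bullet> (\<Sum>b\<in>Basis. f' b *\<^sub>R b)" for h
  proof -
    have "f' h = f' (\<Sum>b\<in>Basis. (h \<bullet> b) *\<^sub>R b)" by (simp add: euclidean_representation)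
    also have "\<dots> = (\<Sum>b\<in>Basis. (h \<bullet> b) * f' b)" by (simp add: sum scale)
    also have "\<dots> = h \<bullet> (\<Sum>b\<in>Basis. f' b *\<^sub>R b)" by (simp add: inner_sum_right mult.commute)
    finally show ?thesis .
  qed
  have eq: "(\<lambda>h. h \<bullet> (\<Sum>b\<in>Basis. f' b *\<^sub>R b)) = f'"
    by (rule ext) (rule inner[symmetric])
  have "GDERIV f x :> (\<Sum>b\<in>Basis. f' b *\<^sub>R b)" unfolding gderiv_def eq by (rule assms)
  then show grad: "gradient f x = (\<Sum>b\<in>Basis. f' b *\<^sub>R b)" by (rule gradient_eq)
  show "f' h = h \<bullet> gradient f x" unfolding grad by (rule inner)
qed

text \<open>
The gradients are the images of the total derivative under fixed linear maps, so they inherit its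
continuity.
\<close>
lemma class_C2_gradients:
  fixes f :: "'a::euclidean_space \<Rightarrow> 'a \<Rightarrow> real"
  assumes "class_C2 (\<lambda>(x, v). f x v)"
  shows class_C2_has_derivative: "\<And>y v. ((\<lambda>(x, v). f x v) has_derivative
          (\<lambda>(p, q). p \<bullet> gradient (\<lambda>x. f x v) y + q \<bullet> gradient (\<lambda>w. f y w) v)) (at (y, v))"
    and class_C2_continuous_gradient_fst: "\<And>z. isCont (\<lambda>(y, v). gradient (\<lambda>x. f x v) y) z"
    and class_C2_continuous_gradient_snd: "\<And>z. isCont (\<lambda>(y, v). gradient (\<lambda>w. f y w) v) z"
proof -
  let ?f = "\<lambda>(x, v). f x v"
  obtain f' :: "'a \<times> 'a \<Rightarrow> ('a \<times> 'a) \<Rightarrow>\<^sub>L real" and f'' :: "'a \<times> 'a \<Rightarrow> ('a \<times> 'a) \<Rightarrow>\<^sub>L ('a \<times> 'a) \<Rightarrow>\<^sub>L real"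
    where f': "\<And>z. (?f has_derivative blinfun_apply (f' z)) (at z)"
      and f'': "\<And>z. (f' has_derivative blinfun_apply (f'' z)) (at z)"
    using assms unfolding class_C2_def by auto
  have D1: "((\<lambda>x. f x v) has_derivative (\<lambda>h. f' (y, v) (h, 0))) (at y)" for y v
  proof -
    have "((\<lambda>x. (x, v)) has_derivative (\<lambda>h. (h, 0))) (at y)" by (auto intro!: derivative_eq_intros)
    from has_derivative_compose[OF this f'] show ?thesis by simp
  qed
  have D2: "((\<lambda>w. f y w) has_derivative (\<lambda>h. f' (y, v) (0, h))) (at v)" for y v
  proof -
    have "((\<lambda>w. (y, w)) has_derivative (\<lambda>h. (0, h))) (at v)" by (auto intro!: derivative_eq_intros)
    from has_derivative_compose[OF this f'] show ?thesis by simp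
  qed
  have cont: "isCont f' z" for z using f'' has_derivative_continuous by blast
  have eq1: "(\<lambda>(y, v). gradient (\<lambda>x. f x v) y) = (\<lambda>z. \<Sum>b\<in>Basis. f' z (b, 0) *\<^sub>R b)"
    using gradient_sum_Basis[OF D1] by auto
  have eq2: "(\<lambda>(y, v). gradient (\<lambda>w. f y w) v) = (\<lambda>z. \<Sum>b\<in>Basis. f' z (0, b) *\<^sub>R b)"
    using gradient_sum_Basis[OF D2] by auto
  show "isCont (\<lambda>(y, v). gradient (\<lambda>x. f x v) y) z" for z unfolding eq1 by (intro continuous_intros cont)
  show "isCont (\<lambda>(y, v). gradient (\<lambda>w. f y w) v) z" for z unfolding eq2 by (intro continuous_intros cont)
  show "(?f has_derivative
          (\<lambda>(p, q). p \<bullet> gradient (\<lambda>x. f x v) y + q \<bullet> gradient (\<lambda>w. f y w) v)) (at (y, v))" for y v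
  proof -
    have "f' (y, v) (p, q) = p \<bullet> gradient (\<lambda>x. f x v) y + q \<bullet> gradient (\<lambda>w. f y w) v" for p q
    proof -
      have "f' (y, v) (p, q) = f' (y, v) ((p, 0) + (0, q))" by simp
      also have "\<dots> = f' (y, v) (p, 0) + f' (y, v) (0, q)" by (rule blinfun.add_right)
      finally show ?thesis by (simp only: derivative_inner_gradient[OF D1] derivative_inner_gradient[OF D2])
    qed
    then have "blinfun_apply (f' (y, v)) = (\<lambda>(p, q). p \<bullet> gradient (\<lambda>x. f x v) y + q \<bullet> gradient (\<lambda>w. f y w) v)"
      by auto
    then show ?thesis using f'[of "(y, v)"] by simp
  qed
qed

lemma class_C2_line_derivative:
  fixes f :: "'a::euclidean_space \<Rightarrow> 'a \<Rightarrow> real"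
  assumes "class_C2 (\<lambda>(x, v). f x v)"
  shows "((\<lambda>e. f (y + e *\<^sub>R h) (v + e *\<^sub>R w)) has_real_derivative
     h \<bullet> gradient (\<lambda>x. f x (v + r *\<^sub>R w)) (y + r *\<^sub>R h) +
     w \<bullet> gradient (\<lambda>u. f (y + r *\<^sub>R h) u) (v + r *\<^sub>R w)) (at r)"
proof -
  have "((\<lambda>e. (y + e *\<^sub>R h, v + e *\<^sub>R w)) has_derivative (\<lambda>e. (e *\<^sub>R h, e *\<^sub>R w))) (at r)"
    by (auto intro!: derivative_eq_intros)
  from has_derivative_compose[OF this class_C2_has_derivative[OF assms]]
  have "((\<lambda>e. f (y + e *\<^sub>R h) (v + e *\<^sub>R w)) has_derivative
      (\<lambda>e. (e *\<^sub>R h) \<bullet> gradient (\<lambda>x. f x (v + r *\<^sub>R w)) (y + r *\<^sub>R h) +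
           (e *\<^sub>R w) \<bullet> gradient (\<lambda>u. f (y + r *\<^sub>R h) u) (v + r *\<^sub>R w))) (at r)"
    by simp
  then show ?thesis unfolding has_field_derivative_def 
    by (rule has_derivative_eq_rhs) (simp add: fun_eq_iff algebra_simps)
qed

lemma dist_triple_le:
  "dist (s, x, w) (s', x', w') \<le> dist s s' + dist x x' + dist w w'"
proof -
  have *: "dist (u, v) (u', v') \<le> dist u u' + dist v v'" 
    for u u' :: "'d::metric_space" and v v' :: "'e::metric_space"
    by (simp add: dist_Pair_Pair sqrt_sum_squares_le_sum)
  show ?thesis using *[of s "(x, w)" s' "(x', w')"] *[of x w x' w'] by linarith
qed

context compact_time_scale
begin

section \<open>Derivative of the functional along a variation\<close>

lemma C1_rd_has_delta_derivative:
  assumes "f \<in> C1_rd T" "t \<in> K"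
  shows "has_delta_derivative T f (delta_deriv T f t) t"
proof -
  obtain D where "has_delta_derivative T f D t" using assms by (auto simp: C1_rd_def)
  then show ?thesis using delta_deriv_eq by metis
qed

lemma primitive_cong:
  assumes "\<And>s. s \<in> K \<Longrightarrow> f s = g s"
  shows "primitive f t = primitive g t"
  unfolding primitive_def using assms floor_K_in by (intro Henstock_Kurzweil_Integration.integral_cong) auto

lemma primitive_eqI:
  assumes "rd_continuous_on T K f" "\<And>t. t \<in> K \<Longrightarrow> has_delta_derivative T F (f t) t"
  shows "primitive f b = F b - F a"
  using delta_integral_primitive[OF assms(1) b_in_T] delta_integral_eqI[of f F, OF _ a_in_T b_in_T] assms(2)
  by (simp add: delta_antiderivative_def)

lemma primitive_minus:
  assumes "rd_continuous_on T K f" "rd_continuous_on T K g"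
  shows "primitive (\<lambda>t. f t - g t) b = primitive f b - primitive g b"
  unfolding primitive_def
  using rd_continuous_integrable[OF assms(1)] rd_continuous_integrable[OF assms(2)]
  by (rule Henstock_Kurzweil_Integration.integral_diff)

text \<open>
The analogue of the two-sided limit for functions with parameters.  The slice over \<open>t\<close> itself has to be
removed, because at a right-scattered point the value of \<open>G\<close> at \<open>t\<close> is unrelated to its limit.
\<close>
lemma jointly_rd_limit:
  assumes G: "jointly_rd_continuous T G" and t: "t \<in> K"
  shows "\<exists>l. ((\<lambda>(s, x, w). G s x w) \<longlongrightarrow> l) (at (t, p, q) within (K - {t}) \<times> UNIV) \<and>
    (right_dense T t \<longrightarrow> l = G t p q)"
proof (cases "right_dense T t")
  case True
  have "continuous (at (t, p, q) within T \<times> UNIV) (\<lambda>(s, x, w). G s x w)"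
    using G True t kappa_in_T unfolding jointly_rd_continuous_def by blast
  then have "((\<lambda>(s, x, w). G s x w) \<longlongrightarrow> G t p q) (at (t, p, q) within T \<times> UNIV)"
    by (simp add: continuous_within)
  then have "((\<lambda>(s, x, w). G s x w) \<longlongrightarrow> G t p q) (at (t, p, q) within (K - {t}) \<times> UNIV)"
    using kappa_in_T by (elim tendsto_within_subset) auto
  then show ?thesis by blast
next
  case False
  note rs = right_scattered_nhd[OF t False]
  have eq: "at (t, p, q) within (K - {t}) \<times> UNIV = at (t, p, q) within {s \<in> K. s < t} \<times> UNIV"
    using rs
    by (intro at_within_nhd[where S = "{..<\<sigma> t} \<times> UNIV"] open_Times) (auto simp: order_le_less)
  have "\<exists>l. ((\<lambda>(s, x, w). G s x w) \<longlongrightarrow> l) (at (t, p, q) within {s \<in> K. s < t} \<times> UNIV)"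
  proof (cases "left_dense T t")
    case True
    then obtain l where "((\<lambda>(s, x, w). G s x w) \<longlongrightarrow> l) (at (t, p, q) within {s \<in> T. s < t} \<times> UNIV)"
      using G t kappa_in_T unfolding jointly_rd_continuous_def by blast
    then have "((\<lambda>(s, x, w). G s x w) \<longlongrightarrow> l) (at (t, p, q) within {s \<in> K. s < t} \<times> UNIV)"
      using kappa_in_T by (elim tendsto_within_subset) auto
    then show ?thesis ..
  next
    case False
    then obtain u where u: "u < t" "\<And>s. s \<in> K \<Longrightarrow> u < s \<Longrightarrow> t \<le> s"
      using left_scattered_nhd[OF t] by blast
    have "at (t, p, q) within {s \<in> K. s < t} \<times> UNIV = at (t, p, q) within {}"
      using u by (intro at_within_nhd[where S = "{u<..} \<times> UNIV"] open_Times) force+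
    then show ?thesis by simp
  qed
  then show ?thesis using False eq by simp
qed

lemma jointly_rd_compose:
  assumes G: "jointly_rd_continuous T G" and p: "rd_continuous_on T K p" and q: "rd_continuous_on T K q"
  shows "rd_continuous_on T K (\<lambda>t. G t (p t) (q t))"
proof (rule rd_continuousI)
  fix t assume t: "t \<in> K"
  obtain lp where lp: "(p \<longlongrightarrow> lp) (at t within K)" "right_dense T t \<Longrightarrow> lp = p t"
    using rd_continuous_limit[OF p t] by blast
  obtain lq where lq: "(q \<longlongrightarrow> lq) (at t within K)" "right_dense T t \<Longrightarrow> lq = q t"
    using rd_continuous_limit[OF q t] by blast
  obtain l where l: "((\<lambda>(s, x, w). G s x w) \<longlongrightarrow> l) (at (t, lp, lq) within (K - {t}) \<times> UNIV)"
      "right_dense T t \<Longrightarrow> l = G t lp lq"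
    using jointly_rd_limit[OF G t] by blast
  have "((\<lambda>s. (s, p s, q s)) \<longlongrightarrow> (t, lp, lq)) (at t within K)"
    by (intro tendsto_intros lp(1) lq(1))
  moreover have "eventually (\<lambda>s. (s, p s, q s) \<in> (K - {t}) \<times> UNIV \<and> (s, p s, q s) \<noteq> (t, lp, lq)) (at t within K)"
    by (auto simp: eventually_at_filter)
  ultimately have "filterlim (\<lambda>s. (s, p s, q s)) (at (t, lp, lq) within (K - {t}) \<times> UNIV) (at t within K)"
    by (simp add: filterlim_at)
  from filterlim_compose[OF l(1) this]
  show "\<exists>l. ((\<lambda>t. G t (p t) (q t)) \<longlongrightarrow> l) (at t within K) \<and> (right_dense T t \<longrightarrow> l = G t (p t) (q t))"
    using l(2) lp(2) lq(2) by auto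
qed

text \<open>
Over the points near \<open>t\<close> the bound comes from the limit of \<open>G\<close> along the limits of \<open>p\<close> and \<open>q\<close>; over \<open>t\<close> itself it
comes from continuity of \<open>G\<close> in its parameters.  Compactness of K makes width and bound uniform.
\<close>
lemma jointly_rd_tube_bounded:
  assumes G: "jointly_rd_continuous T G" and p: "rd_continuous_on T K p" and q: "rd_continuous_on T K q"
    and cont: "\<And>t. t \<in> K \<Longrightarrow> isCont (\<lambda>(x, w). G t x w) (p t, q t)"
  shows "\<exists>\<delta>>0. \<exists>M. \<forall>s\<in>K. \<forall>x w. dist x (p s) \<le> \<delta> \<longrightarrow> dist w (q s) \<le> \<delta> \<longrightarrow> norm (G s x w) \<le> M"
proof -
  (* A single index n controls both the width 1 / (n + 1) of the tube and the bound n on G. *)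
  define Q where "Q n s \<longleftrightarrow> (\<forall>x w. dist x (p s) \<le> 1 / real (Suc n) \<longrightarrow> dist w (q s) \<le> 1 / real (Suc n) \<longrightarrow>
      norm (G s x w) \<le> real n)" for n s
  have "\<exists>n. \<forall>s\<in>K. Q n s"
  proof (rule compact_uniform_nat[OF compact_K])
    show "Q n s" if "Q m s" "m \<le> n" for m n s
      unfolding Q_def
    proof (intro allI impI)
      fix x w assume "dist x (p s) \<le> 1 / real (Suc n)" "dist w (q s) \<le> 1 / real (Suc n)"
      moreover have "1 / real (Suc n) \<le> 1 / real (Suc m)" using that(2) by (simp add: frac_le)
      ultimately have "norm (G s x w) \<le> real m" using that(1) unfolding Q_def by (meson order_trans)
      then show "norm (G s x w) \<le> real n" using that(2) by simp
    qed
  next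
    fix t assume t: "t \<in> K"
    obtain lp where lp: "(p \<longlongrightarrow> lp) (at t within K)" using rd_continuous_limit[OF p t] by blast
    obtain lq where lq: "(q \<longlongrightarrow> lq) (at t within K)" using rd_continuous_limit[OF q t] by blast
    obtain l where l: "((\<lambda>(s, x, w). G s x w) \<longlongrightarrow> l) (at (t, lp, lq) within (K - {t}) \<times> UNIV)"
      using jointly_rd_limit[OF G t] by blast
    obtain d where d: "d > 0" "\<And>s x w. s \<in> K \<Longrightarrow> s \<noteq> t \<Longrightarrow> dist (s, x, w) (t, lp, lq) < d \<Longrightarrow> dist (G s x w) l < 1"
      using tendstoD[OF l, of 1] unfolding eventually_at by auto
    obtain d0 where d0: "d0 > 0" "\<And>x w. dist (x, w) (p t, q t) < d0 \<Longrightarrow> dist (G t x w) (G t (p t) (q t)) < 1"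
      using cont[OF t] unfolding continuous_at_eps_delta by (auto dest: spec[of _ 1])
    (* The distance of (s, x, w) from (t, lp, lq) is at most the sum of five terms: one for s, and for each
       of x and w the width of the tube and the distance of its centre from the limit. *)
    have "eventually (\<lambda>s. dist (p s) lp < d / 5) (at t within K)" using lp d(1) by (intro tendstoD) auto
    then obtain d1 where d1: "d1 > 0" "\<And>s. s \<in> K \<Longrightarrow> s \<noteq> t \<Longrightarrow> dist s t < d1 \<Longrightarrow> dist (p s) lp < d / 5"
      unfolding eventually_at by auto
    have "eventually (\<lambda>s. dist (q s) lq < d / 5) (at t within K)" using lq d(1) by (intro tendstoD) auto
    then obtain d2 where d2: "d2 > 0" "\<And>s. s \<in> K \<Longrightarrow> s \<noteq> t \<Longrightarrow> dist s t < d2 \<Longrightarrow> dist (q s) lq < d / 5"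
      unfolding eventually_at by auto
    obtain n1 where n1: "inverse (real (Suc n1)) < min (d / 5) (d0 / 2)"
      using reals_Archimedean[of "min (d / 5) (d0 / 2)"] d(1) d0(1) by auto
    obtain n2 :: nat where n2: "max (norm l + 1) (norm (G t (p t) (q t)) + 1) \<le> real n2"
      using real_arch_simple by blast
    define n where "n = max n1 n2"
    have "1 / real (Suc n) \<le> inverse (real (Suc n1))" by (simp add: n_def inverse_eq_divide frac_le)
    then have n: "1 / real (Suc n) < d / 5" "1 / real (Suc n) < d0 / 2" using n1 by auto
    have nb: "norm l + 1 \<le> real n" "norm (G t (p t) (q t)) + 1 \<le> real n" using n2 by (auto simp: n_def)
    have "Q n s" if s: "s \<in> K" "dist s t < min (d / 5) (min d1 d2)" for s
      unfolding Q_def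
    proof (intro allI impI)
      fix x w assume xw: "dist x (p s) \<le> 1 / real (Suc n)" "dist w (q s) \<le> 1 / real (Suc n)"
      show "norm (G s x w) \<le> real n"
      proof (cases "s = t")
        case True
        have "dist (x, w) (p t, q t) \<le> dist x (p t) + dist w (q t)"
          by (simp add: dist_Pair_Pair sqrt_sum_squares_le_sum)
        also have "\<dots> < d0" using xw n True by simp
        finally have "dist (G t x w) (G t (p t) (q t)) < 1" by (rule d0(2))
        then have "norm (G t x w) < norm (G t (p t) (q t)) + 1"
          unfolding dist_norm using norm_triangle_ineq2[of "G t x w" "G t (p t) (q t)"] by linarith
        then show ?thesis using nb True by simp
      next
        case False
        have "dist x lp < d / 5 + d / 5" 
          using xw(1) n d1(2)[OF s(1) False] s(2) dist_triangle[of x lp "p s"] by auto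
        moreover have "dist w lq < d / 5 + d / 5" 
          using xw(2) n d2(2)[OF s(1) False] s(2) dist_triangle[of w lq "q s"] by auto
        ultimately have "dist (s, x, w) (t, lp, lq) < d"
          using dist_triple_le[of s x w t lp lq] s(2) by linarith
        from d(2)[OF s(1) False this] have "norm (G s x w) < norm l + 1"
          unfolding dist_norm using norm_triangle_ineq2[of "G s x w" l] by linarith
        then show ?thesis using nb by simp
      qed
    qed
    then show "\<exists>d>0. \<exists>n. \<forall>s\<in>K. dist s t < d \<longrightarrow> Q n s"
      using d(1) d1(1) d2(1) by (intro exI[of _ "min (d / 5) (min d1 d2)"]) auto
  qed
  then obtain n where n: "\<forall>s\<in>K. Q n s" ..
  show ?thesis
    using n unfolding Q_def by (intro exI[of _ "1 / real (Suc n)"] exI[of _ "real n"] conjI) auto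
qed

text \<open>
For small \<open>e\<close> the curves stay in a tube on which both gradients are bounded, so by the mean value theorem the
difference quotients are bounded by a constant.  They converge pointwise, and dominated
convergence along every sequence \<open>e\<^sub>k \<rightarrow> 0\<close> differentiates under the integral.
\<close>
lemma first_variation:
  fixes L :: "real \<Rightarrow> 'a::euclidean_space \<Rightarrow> 'a \<Rightarrow> real"
  assumes C2: "\<And>t. t \<in> K \<Longrightarrow> class_C2 (\<lambda>(x, v). L t x v)"
    and L: "jointly_rd_continuous T L"
    and Ly: "jointly_rd_continuous T (grad_y L)"
    and Lv: "jointly_rd_continuous T (grad_v L)"
    and y: "rd_continuous_on T K y" and v: "rd_continuous_on T K v"
    and h: "rd_continuous_on T K h" and w: "rd_continuous_on T K w"
  shows "((\<lambda>e. primitive (\<lambda>t. L t (y t + e *\<^sub>R h t) (v t + e *\<^sub>R w t)) b) has_real_derivative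
      primitive (\<lambda>t. h t \<bullet> grad_y L t (y t) (v t) + w t \<bullet> grad_v L t (y t) (v t)) b) (at 0)"
proof -
  let ?g = "\<lambda>e t. L t (y t + e *\<^sub>R h t) (v t + e *\<^sub>R w t)"
  let ?g' = "\<lambda>e t. h t \<bullet> grad_y L t (y t + e *\<^sub>R h t) (v t + e *\<^sub>R w t)
                 + w t \<bullet> grad_v L t (y t + e *\<^sub>R h t) (v t + e *\<^sub>R w t)"
  have g': "(((\<lambda>e. ?g e t) has_real_derivative ?g' r t) (at r))" if "t \<in> K" for t r
    unfolding grad_y_def grad_v_def by (rule class_C2_line_derivative[OF C2[OF that]])
  obtain \<delta>1 M1 where 1: "\<delta>1 > 0" "\<And>s x u. s \<in> K \<Longrightarrow> dist x (y s) \<le> \<delta>1 \<Longrightarrow> dist u (v s) \<le> \<delta>1 \<Longrightarrow>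
      norm (grad_y L s x u) \<le> M1"
    using jointly_rd_tube_bounded[OF Ly y v] class_C2_continuous_gradient_fst[OF C2] 
    unfolding grad_y_def by metis
  obtain \<delta>2 M2 where 2: "\<delta>2 > 0" "\<And>s x u. s \<in> K \<Longrightarrow> dist x (y s) \<le> \<delta>2 \<Longrightarrow> dist u (v s) \<le> \<delta>2 \<Longrightarrow>
      norm (grad_v L s x u) \<le> M2"
    using jointly_rd_tube_bounded[OF Lv y v] class_C2_continuous_gradient_snd[OF C2] 
    unfolding grad_v_def by metis
  obtain Bh where Bh: "\<And>t. t \<in> K \<Longrightarrow> norm (h t) \<le> Bh" using rd_continuous_bounded[OF h] by blast
  obtain Bw where Bw: "\<And>t. t \<in> K \<Longrightarrow> norm (w t) \<le> Bw" using rd_continuous_bounded[OF w] by blast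
  have nn: "Bh \<ge> 0" "Bw \<ge> 0" using Bh[OF a_in_K] Bw[OF a_in_K] norm_ge_zero order_trans by blast+
  (* With this bound on e, both e h and e w stay inside the two tubes. *)
  define \<eta> where "\<eta> = min \<delta>1 \<delta>2 / (Bh + Bw + 1)"
  have \<eta>: "\<eta> > 0" using 1(1) 2(1) nn by (simp add: \<eta>_def)
  define C where "C = Bh * M1 + Bw * M2"
  have small: "norm (e *\<^sub>R h t) \<le> min \<delta>1 \<delta>2" "norm (e *\<^sub>R w t) \<le> min \<delta>1 \<delta>2" if "\<bar>e\<bar> < \<eta>" "t \<in> K" for e t
  proof -
    have "norm (e *\<^sub>R h t) \<le> \<eta> * (Bh + Bw + 1)"
      using Bh[OF that(2)] nn that(1) unfolding norm_scaleR by (intro mult_mono) auto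
    then show "norm (e *\<^sub>R h t) \<le> min \<delta>1 \<delta>2" using nn by (simp add: \<eta>_def add_nonneg_eq_0_iff)
    have "norm (e *\<^sub>R w t) \<le> \<eta> * (Bh + Bw + 1)"
      using Bw[OF that(2)] nn that(1) unfolding norm_scaleR by (intro mult_mono) auto
    then show "norm (e *\<^sub>R w t) \<le> min \<delta>1 \<delta>2" using nn by (simp add: \<eta>_def add_nonneg_eq_0_iff)
  qed
  have bound': "norm (?g' e t) \<le> C" if "\<bar>e\<bar> < \<eta>" "t \<in> K" for e t
  proof -
    have "norm (?g' e t) \<le> norm (h t) * norm (grad_y L t (y t + e *\<^sub>R h t) (v t + e *\<^sub>R w t))
        + norm (w t) * norm (grad_v L t (y t + e *\<^sub>R h t) (v t + e *\<^sub>R w t))"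
      unfolding real_norm_def
      by (intro order_trans[OF abs_triangle_ineq] add_mono Cauchy_Schwarz_ineq2)
    also have "\<dots> \<le> Bh * M1 + Bw * M2"
      using small[OF that] that nn Bh Bw
      by (intro add_mono mult_mono 1(2) 2(2)) (auto simp: dist_norm)
    finally show ?thesis by (simp add: C_def)
  qed
  have quot: "norm ((?g e t - ?g 0 t) / e) \<le> C" if "\<bar>e\<bar> < \<eta>" "e \<noteq> 0" "t \<in> K" for e t
  proof -
    have "norm (?g e t - ?g 0 t) \<le> C * norm (e - 0)"
    proof (rule field_differentiable_bound[where S = "ball 0 \<eta>" and f' = "\<lambda>r. ?g' r t"])
      show "((\<lambda>e. ?g e t) has_field_derivative ?g' r t) (at r within ball 0 \<eta>)" for r
        using g'[OF that(3)] by (rule has_field_derivative_at_within)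
      show "norm (?g' r t) \<le> C" if "r \<in> ball 0 \<eta>" for r using bound'[of r t] that \<open>t \<in> K\<close> by simp
    qed (use that \<eta> in auto)
    then show ?thesis using that(2) by (simp add: norm_divide field_simps)
  qed
  have rdg: "rd_continuous_on T K (?g e)" for e
    by (intro jointly_rd_compose[OF L] rd_continuous_add rd_continuous_scaleR y v h w)
  have "((\<lambda>e. (primitive (?g e) b - primitive (?g 0) b) / e) \<longlongrightarrow> primitive (?g' 0) b) (at 0 within ball 0 \<eta>)"
    unfolding tendsto_at_iff_sequentially comp_def
  proof (intro allI impI)
    fix X :: "nat \<Rightarrow> real" assume X: "\<forall>i. X i \<in> ball 0 \<eta> - {0}" "X \<longlonglongrightarrow> 0"
    let ?D = "\<lambda>k x. (?g (X k) (floor_K x) - ?g 0 (floor_K x)) / X k"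
    have Dint: "?D k integrable_on {a..b}" for k
      by (intro integrable_on_divide integrable_diff rd_continuous_integrable rdg)
    have "(\<lambda>k. integral {a..b} (?D k)) \<longlonglongrightarrow> integral {a..b} (\<lambda>x. ?g' 0 (floor_K x))"
    proof (rule dominated_convergence(2)[where h = "\<lambda>_. C"])
      fix k x assume x: "x \<in> {a..b}"
      then show "norm (?D k x) \<le> C" using X(1) floor_K_in by (intro quot) (auto simp: dist_real_def)
    next
      fix x assume x: "x \<in> {a..b}"
      then have "((\<lambda>e. (?g (0 + e) (floor_K x) - ?g 0 (floor_K x)) / e) \<longlongrightarrow> ?g' 0 (floor_K x)) (at 0)"
        using g'[of "floor_K x" 0] floor_K_in[of x] by (simp only: DERIV_def) auto
      moreover have "filterlim X (at 0) sequentially"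
        using X by (auto simp: filterlim_at)
      ultimately show "(\<lambda>k. ?D k x) \<longlonglongrightarrow> ?g' 0 (floor_K x)"
        using filterlim_compose by fastforce
    qed (use Dint in auto)
    then have "(\<lambda>k. integral {a..b} (?D k)) \<longlonglongrightarrow> primitive (?g' 0) b"
      by (simp only: primitive_def)
    moreover have "integral {a..b} (?D k) = (primitive (?g (X k)) b - primitive (?g 0) b) / X k" for k
    proof -
      have "integral {a..b} (?D k) = primitive (\<lambda>t. ?g (X k) t - ?g 0 t) b / X k"
        unfolding primitive_def by (rule integral_divide)
      then show ?thesis by (simp only: primitive_minus[OF rdg rdg])
    qed
    ultimately show "(\<lambda>k. (primitive (?g (X k)) b - primitive (?g 0) b) / X k) \<longlonglongrightarrow> primitive (?g' 0) b"
      by (simp only:)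
  qed
  moreover have "at (0::real) within ball 0 \<eta> = at 0"
    using \<eta> by (intro at_within_open) auto
  ultimately show ?thesis unfolding DERIV_def by (simp only: add_0 add_0_right scaleR_zero_left)
qed

section \<open>The du Bois-Reymond lemma and the Euler-Lagrange equation\<close>

text \<open>
Test with \<open>w = g - c\<close>, where \<open>c\<close> is the mean of \<open>g\<close>: then \<open>w\<close> has integral zero and is orthogonal both to \<open>g\<close> and to
\<open>c\<close>, so \<open>|g - c|\<^sup>2\<close> has integral zero.
\<close>
lemma du_bois_reymond:
  fixes g :: "real \<Rightarrow> 'a::euclidean_space"
  assumes g: "rd_continuous_on T K g"
    and orth: "\<And>w. rd_continuous_on T K w \<Longrightarrow> primitive w b = 0 \<Longrightarrow> primitive (\<lambda>t. w t \<bullet> g t) b = 0"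
  shows "\<exists>c. \<forall>t\<in>K. g t = c"
proof -
  define c where "c = (1 / (b - a)) *\<^sub>R primitive g b"
  let ?w = "\<lambda>t. g t - c"
  have w: "rd_continuous_on T K ?w" by (intro rd_continuous_diff g rd_continuous_const)
  have c: "primitive (\<lambda>t. c) b = (b - a) *\<^sub>R c"
    using primitive_eqI[OF rd_continuous_const has_delta_derivative_affine, of c a] by simp
  have w0: "primitive ?w b = 0"
    using primitive_minus[OF g rd_continuous_const[of c]] a_less_b by (simp add: c) (simp add: c_def)
  have dw: "has_delta_derivative T (primitive ?w) (?w t) t" if "t \<in> K" for t
    using primitive_antiderivative[OF w] that by (simp add: delta_antiderivative_def)
  have wc: "primitive (\<lambda>t. ?w t \<bullet> c) b = 0"
  proof -
    have "has_delta_derivative T (\<lambda>s. primitive ?w s \<bullet> c) (?w t \<bullet> c) t" if "t \<in> K" for t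
      using has_delta_derivative_inner[OF dw[OF that] has_delta_derivative_const[OF that, of c]] by simp
    from primitive_eqI[OF rd_continuous_inner[OF w rd_continuous_const] this] show ?thesis by (simp add: w0)
  qed
  have "primitive (\<lambda>t. ?w t \<bullet> g t - ?w t \<bullet> c) b = 0"
    using primitive_minus[OF rd_continuous_inner[OF w g] rd_continuous_inner[OF w rd_continuous_const[of c]]]
      orth[OF w w0] wc by simp
  then have sq: "primitive (\<lambda>t. ?w t \<bullet> ?w t) b = 0" by (simp add: inner_diff_right)
  have "g t = c" if "t \<in> K" for t
    using primitive_nonneg_zero[OF rd_continuous_inner[OF w w] _ sq that] by simp
  then show ?thesis by blast
qed

text \<open>
The norm of \<open>e h\<close> is at most \<open>|e|\<close> times a constant, so all small \<open>e\<close> compete with the minimizer and the functional along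
the line has a local minimum at 0.
\<close>
lemma weak_local_minimizer_first_variation:
  fixes L :: "real \<Rightarrow> 'a::euclidean_space \<Rightarrow> 'a \<Rightarrow> real"
  assumes C2: "\<And>t. t \<in> K \<Longrightarrow> class_C2 (\<lambda>(x, v). L t x v)"
    and L: "jointly_rd_continuous T L"
    and Ly: "jointly_rd_continuous T (grad_y L)"
    and Lv: "jointly_rd_continuous T (grad_v L)"
    and min: "weak_local_minimizer T a b L y\<^sub>a y\<^sub>b y"
    and h: "\<And>t. t \<in> K \<Longrightarrow> has_delta_derivative T h (w t) t"
    and w: "rd_continuous_on T K w"
    and ha: "y\<^sub>a \<noteq> None \<Longrightarrow> h a = 0" and hb: "y\<^sub>b \<noteq> None \<Longrightarrow> h b = 0"
  shows "primitive (\<lambda>t. h t \<bullet> grad_y L t (y t) (delta_deriv T y t) +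
                        w t \<bullet> grad_v L t (y t) (delta_deriv T y t)) b = 0"
proof -
  let ?v = "delta_deriv T y"
  let ?x = "\<lambda>e t. y t + e *\<^sub>R h t"
  have adm: "y \<in> admissible T a b y\<^sub>a y\<^sub>b" using min by (simp add: weak_local_minimizer_def)
  obtain \<delta> where \<delta>: "\<delta> > 0" "\<And>x. x \<in> admissible T a b y\<^sub>a y\<^sub>b \<Longrightarrow>
     norm_1_inf T (\<lambda>t. x t - y t) < \<delta> \<Longrightarrow> functional T a b L y \<le> functional T a b L x"
    using min unfolding weak_local_minimizer_def by blast
  have dy: "has_delta_derivative T y (?v t) t" if "t \<in> K" for t
    using adm that by (intro C1_rd_has_delta_derivative) (auto simp: admissible_def)
  have rv: "rd_continuous_on T K ?v" using adm by (auto simp: admissible_def C1_rd_def)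
  have ry: "rd_continuous_on T K y" by (rule delta_differentiable_rd_continuous[OF dy])
  have rh: "rd_continuous_on T K h" by (rule delta_differentiable_rd_continuous[OF h])
  have dx: "has_delta_derivative T (?x e) (?v t + e *\<^sub>R w t) t" if "t \<in> K" for e t
    by (intro has_delta_derivative_add has_delta_derivative_scaleR dy h that)
  have vx: "delta_deriv T (?x e) t = ?v t + e *\<^sub>R w t" if "t \<in> K" for e t
    by (rule delta_deriv_eq[OF dx[OF that]])
  have rvx: "rd_continuous_on T K (\<lambda>t. ?v t + e *\<^sub>R w t)" for e
    by (intro rd_continuous_add rd_continuous_scaleR rv w)
  have xadm: "?x e \<in> admissible T a b y\<^sub>a y\<^sub>b" for e
  proof -
    have "?x e \<in> C1_rd T"
      unfolding C1_rd_def using dx rd_continuous_cong[of "delta_deriv T (?x e)", OF vx] rvx by blast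
    then show ?thesis using adm ha hb by (auto simp: admissible_def)
  qed
  let ?\<Phi> = "\<lambda>e. primitive (\<lambda>t. L t (?x e t) (?v t + e *\<^sub>R w t)) b"
  have \<Phi>: "functional T a b L (?x e) = ?\<Phi> e" for e
  proof -
    let ?F = "\<lambda>t. L t (?x e t) (delta_deriv T (?x e) t)"
    let ?G = "\<lambda>t. L t (?x e t) (?v t + e *\<^sub>R w t)"
    have eq: "?F t = ?G t" if "t \<in> K" for t
      using vx[OF that] by simp
    have "rd_continuous_on T K ?G"
      by (intro jointly_rd_compose[OF L] rd_continuous_add rd_continuous_scaleR ry rh rv w)
    then have "rd_continuous_on T K ?F"
      using rd_continuous_cong[of ?F ?G, OF eq] by blast
    from delta_integral_primitive[OF this b_in_T] show ?thesis
      unfolding functional_def using primitive_cong[of ?F ?G b, OF eq] by simp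
  qed
  obtain Bh where Bh: "\<And>t. t \<in> K \<Longrightarrow> norm (h t) \<le> Bh" using rd_continuous_bounded[OF rh] by blast
  obtain Bw where Bw: "\<And>t. t \<in> K \<Longrightarrow> norm (w t) \<le> Bw" using rd_continuous_bounded[OF w] by blast
  have nn: "Bh \<ge> 0" "Bw \<ge> 0" using Bh[OF a_in_K] Bw[OF a_in_K] norm_ge_zero order_trans by blast+
  have near: "norm_1_inf T (\<lambda>t. ?x e t - y t) < \<delta>" if e: "\<bar>e\<bar> < \<delta> / (Bh + Bw + 1)" for e
  proof -
    have 1: "(SUP t\<in>K. norm (?x e t - y t)) \<le> \<bar>e\<bar> * Bh"
      using a_in_K Bh by (intro cSUP_least) (auto intro: mult_left_mono)
    have "delta_deriv T (\<lambda>t. ?x e t - y t) t = e *\<^sub>R w t" if "t \<in> K" for t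
      using delta_deriv_eq[OF has_delta_derivative_scaleR[OF h[OF that], of e]] by simp
    then have 2: "(SUP t\<in>K. norm (delta_deriv T (\<lambda>t. ?x e t - y t) t)) \<le> \<bar>e\<bar> * Bw"
      using a_in_K Bw by (intro cSUP_least) (auto intro: mult_left_mono)
    have "norm_1_inf T (\<lambda>t. ?x e t - y t) \<le> \<bar>e\<bar> * Bh + \<bar>e\<bar> * Bw"
      unfolding norm_1_inf_def using 1 2 by (rule add_mono)
    also have "\<dots> \<le> \<bar>e\<bar> * (Bh + Bw + 1)" by (simp add: algebra_simps)
    also have "\<dots> < \<delta>" using e nn by (simp add: pos_less_divide_eq)
    finally show ?thesis .
  qed
  have "(?\<Phi> has_real_derivative
      primitive (\<lambda>t. h t \<bullet> grad_y L t (y t) (?v t) + w t \<bullet> grad_v L t (y t) (?v t)) b) (at 0)"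
    by (rule first_variation[OF C2 L Ly Lv ry rv rh w])
  then show ?thesis
  proof (rule DERIV_local_min)
    show "0 < \<delta> / (Bh + Bw + 1)" using \<delta>(1) nn by simp
    show "\<forall>e. \<bar>0 - e\<bar> < \<delta> / (Bh + Bw + 1) \<longrightarrow> ?\<Phi> 0 \<le> ?\<Phi> e"
      using \<delta>(2)[OF xadm near] \<Phi> \<Phi>[of 0] by simp
  qed
qed

text \<open>
The same identity for the variations is used twice.  Variations with \<open>h(a) = h(b) = 0\<close> suffice for the equation with
some \<open>c\<close>.  Once the equation is known, an affine variation that vanishes at the opposite end turns the freedom at
an endpoint into a condition on \<open>c\<close>.
\<close>
theorem euler_lagrange:
  fixes L :: "real \<Rightarrow> 'a::euclidean_space \<Rightarrow> 'a \<Rightarrow> real"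
  assumes C2: "\<And>t. t \<in> K \<Longrightarrow> class_C2 (\<lambda>(x, v). L t x v)"
    and L: "jointly_rd_continuous T L"
    and Ly: "jointly_rd_continuous T (grad_y L)"
    and Lv: "jointly_rd_continuous T (grad_v L)"
    and min: "weak_local_minimizer T a b L y\<^sub>a y\<^sub>b y"
  defines "A \<equiv> primitive (\<lambda>t. grad_y L t (y t) (delta_deriv T y t))"
  obtains c where "\<And>t. t \<in> K \<Longrightarrow> grad_v L t (y t) (delta_deriv T y t) = A (\<sigma> t) + c"
    and "y\<^sub>a = None \<Longrightarrow> c = 0" and "y\<^sub>b = None \<Longrightarrow> A b + c = 0"
    and "rd_continuous_on T K (\<lambda>t. grad_y L t (y t) (delta_deriv T y t))"
proof -
  let ?v = "delta_deriv T y"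
  let ?P = "\<lambda>t. grad_y L t (y t) (?v t)"
  let ?R = "\<lambda>t. grad_v L t (y t) (?v t)"
  let ?g = "\<lambda>t. ?R t - A (\<sigma> t)"
  have adm: "y \<in> C1_rd T" using min by (simp add: weak_local_minimizer_def admissible_def)
  then have rv: "rd_continuous_on T K ?v" by (simp add: C1_rd_def)
  have ry: "rd_continuous_on T K y"
    using C1_rd_has_delta_derivative[OF adm] by (rule delta_differentiable_rd_continuous)
  have rP: "rd_continuous_on T K ?P" by (rule jointly_rd_compose[OF Ly ry rv])
  have rR: "rd_continuous_on T K ?R" by (rule jointly_rd_compose[OF Lv ry rv])
  have rA: "rd_continuous_on T K (\<lambda>t. A (\<sigma> t))"
    unfolding A_def by (intro rd_continuous_compose_fwd_jump primitive_continuous rP)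
  have rg: "rd_continuous_on T K ?g" by (intro rd_continuous_diff rR rA)
  have dA: "has_delta_derivative T A (?P t) t" if "t \<in> K" for t
    using primitive_antiderivative[OF rP] that by (simp add: A_def delta_antiderivative_def)
  have var: "primitive (\<lambda>t. w t \<bullet> ?g t) b = - (A b \<bullet> h b)"
    if h: "\<And>t. t \<in> K \<Longrightarrow> has_delta_derivative T h (w t) t" and w: "rd_continuous_on T K w"
      and ha: "y\<^sub>a \<noteq> None \<Longrightarrow> h a = 0" and hb: "y\<^sub>b \<noteq> None \<Longrightarrow> h b = 0" for h w
  proof -
    let ?V = "\<lambda>t. h t \<bullet> ?P t + w t \<bullet> ?R t"
    let ?W = "\<lambda>t. ?P t \<bullet> h t + A (\<sigma> t) \<bullet> w t"
    have rh: "rd_continuous_on T K h" by (rule delta_differentiable_rd_continuous[OF h])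
    have rV: "rd_continuous_on T K ?V" by (intro rd_continuous_add rd_continuous_inner rh rP w rR)
    have rW: "rd_continuous_on T K ?W" by (intro rd_continuous_add rd_continuous_inner rh rP w rA)
    have "primitive ?W b = A b \<bullet> h b - A a \<bullet> h a"
      by (rule primitive_eqI[OF rW]) (intro has_delta_derivative_inner dA h)
    moreover have "primitive ?V b = 0"
      by (rule weak_local_minimizer_first_variation[OF C2 L Ly Lv min h w ha hb])
    moreover have "primitive (\<lambda>t. w t \<bullet> ?g t) b = primitive (\<lambda>t. ?V t - ?W t) b"
      by (rule primitive_cong) (simp add: inner_diff_right inner_commute)
    ultimately show ?thesis using primitive_minus[OF rV rW] by (simp add: A_def)
  qed
  have "\<exists>c. \<forall>t\<in>K. ?g t = c"
  proof (rule du_bois_reymond[OF rg])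
    fix w :: "real \<Rightarrow> 'a" assume w: "rd_continuous_on T K w" and w0: "primitive w b = 0"
    (* The primitive of w vanishes at both ends, so it is admissible for every boundary condition. *)
    have "primitive (\<lambda>t. w t \<bullet> ?g t) b = - (A b \<bullet> primitive w b)"
      using primitive_antiderivative[OF w] w w0 
      by (intro var) (auto simp: delta_antiderivative_def)
    then show "primitive (\<lambda>t. w t \<bullet> ?g t) b = 0" by (simp add: w0)
  qed
  then obtain c where c: "\<And>t. t \<in> K \<Longrightarrow> ?g t = c" by blast
  (* The constant w = u, whose antiderivative is normalised to vanish at \<alpha>; a prescribed endpoint
     forces \<alpha> to be that endpoint, and if both are prescribed no \<alpha> qualifies. *)
  have lin: "(b - a) * (u \<bullet> c) = - (A b \<bullet> ((b - \<alpha>) *\<^sub>R u))"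
    if "y\<^sub>a \<noteq> None \<Longrightarrow> \<alpha> = a" "y\<^sub>b \<noteq> None \<Longrightarrow> \<alpha> = b" for u \<alpha>
  proof -
    have "primitive (\<lambda>t. u \<bullet> ?g t) b = - (A b \<bullet> ((b - \<alpha>) *\<^sub>R u))"
      using that by (intro var has_delta_derivative_affine rd_continuous_const) auto
    moreover have "primitive (\<lambda>t. u \<bullet> ?g t) b = (b - a) *\<^sub>R (u \<bullet> c) - (a - a) *\<^sub>R (u \<bullet> c)"
      using c by (intro primitive_eqI rd_continuous_inner rd_continuous_const rg)
        (simp add: has_delta_derivative_affine del: real_scaleR_def)
    ultimately show ?thesis by simp
  qed
  show ?thesis
  proof (rule that[OF _ _ _ rP])
    show "?R t = A (\<sigma> t) + c" if "t \<in> K" for t using c[OF that] by (simp add: algebra_simps)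
    show "c = 0" if "y\<^sub>a = None"
      using lin[of b c] that a_less_b by simp
    show "A b + c = 0" if "y\<^sub>b = None"
    proof -
      let ?u = "A b + c"
      have "(b - a) * (?u \<bullet> c) = - ((b - a) * (A b \<bullet> ?u))"
        using lin[of a ?u] that by simp
      moreover have "?u \<bullet> ?u = A b \<bullet> ?u + ?u \<bullet> c"
        by (simp add: inner_add_left inner_add_right inner_commute)
      ultimately have "(b - a) * (?u \<bullet> ?u) = 0" by (simp add: distrib_left)
      then show ?thesis using a_less_b by simp
    qed
  qed
qed

end

theorem theorem2:
  fixes T\<^sub>0 T :: "real set" and a b :: real
    and L :: "real \<Rightarrow> real ^ 'n \<Rightarrow> real ^ 'n \<Rightarrow> real"
    and y\<^sub>a y\<^sub>b :: "(real ^ 'n) option"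
    and y :: "real \<Rightarrow> real ^ 'n"
  assumes "time_scale T\<^sub>0" and "a < b" and "T = {a..b} \<inter> T\<^sub>0" and "a \<in> T" and "b \<in> T"
    and three_points: "\<exists>S\<subseteq>T. card S = 3"
    and C2: "\<And>t. t \<in> T \<Longrightarrow> class_C2 (\<lambda>(x, v). L t x v)"
    and rd_L: "jointly_rd_continuous T L"
    and rd_Ly: "jointly_rd_continuous T (grad_y L)"
    and rd_Lv: "jointly_rd_continuous T (grad_v L)"
    and minimizer: "weak_local_minimizer T a b L y\<^sub>a y\<^sub>b y"
  shows "(\<exists>c. \<forall>t\<in>ts_kappa T.
            grad_v L t (y t) (delta_deriv T y t) =
              delta_integral T (\<lambda>\<xi>. grad_y L \<xi> (y \<xi>) (delta_deriv T y \<xi>)) a (fwd_jump T t) + c) \<and>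
         (y\<^sub>a = None \<longrightarrow>
            grad_v L a (y a) (delta_deriv T y a)
              - graininess T a *\<^sub>R grad_y L a (y a) (delta_deriv T y a) = 0) \<and>
         (y\<^sub>b = None \<longrightarrow>
            grad_v L (bwd_jump T b) (y (bwd_jump T b)) (delta_deriv T y (bwd_jump T b)) = 0)"
proof -
  interpret compact_time_scale T a b
    using assms(1-5) by unfold_locales (auto simp: time_scale_def)
  let ?P = "\<lambda>t. grad_y L t (y t) (delta_deriv T y t)"
  obtain c where c: "\<And>t. t \<in> K \<Longrightarrow> grad_v L t (y t) (delta_deriv T y t) = primitive ?P (\<sigma> t) + c"
    "y\<^sub>a = None \<Longrightarrow> c = 0" "y\<^sub>b = None \<Longrightarrow> primitive ?P b + c = 0" and P: "rd_continuous_on T K ?P"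
    using euler_lagrange[OF C2[OF kappa_in_T] rd_L rd_Ly rd_Lv minimizer] by blast
  have int: "delta_integral T ?P a (\<sigma> t) = primitive ?P (\<sigma> t)" if "t \<in> K" for t
    by (rule delta_integral_primitive[OF P fwd_jump_in[OF kappa_in_T[OF that]]])
  have "primitive ?P (\<sigma> a) = graininess T a *\<^sub>R ?P a"
    using primitive_jump[OF P a_in_K] by (simp add: graininess_def)
  then show ?thesis
    using c int a_in_K bwd_jump_b_kappa by auto
qed

end
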